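(* Let $A$ be a finitely generated group with a (not necessarily finite) generating set $T$, and let $\mathcal{H}$ be a finite collection of infinite subgroups of $A$ such that $\mathcal{H}\hookrightarrow_h(A,T)$. If $F\le\mathrm{Aut}(A)$ is finite, $T$ and $\mathcal{H}$ are $F$-invariant, and the $F$-action on $\mathcal{H}$ is free, then $\mathcal{H}_F\hookrightarrow_h(A\rtimes F,\,T\cup F)$, where $\mathcal{H}_F$ is a collection of representatives of $F$-orbits in $\mathcal{H}$.
   Context: $A\rtimes F$ is the semidirect product for the natural action of $F$ on $A$, and $A$, $F$ are regarded as subgroups of $A\rtimes F$. $T$ being $F$-invariant means $f(T)=T$ for all $f\in F$; $\mathcal{H}$ being $F$-invariant means $f(K)\in\mathcal{H}$ for all $f\in F$, $K\in\mathcal{H}$; the action on $\mathcal{H}$ is free if $f(K)=K$ for some $K\in\mathcal{H}$ implies $f=1$. For a collection $\mathcal{P}$ of subgroups of $G$, $G/\mathcal{P}$ denotes the set of all left cosets $gP$ with $g\in G$, $P\in\mathcal{P}$. Hyperbolically embedded: for a collection $\mathcal{P}$ of infinite subgroups of $G$ and $S\subset G$, the coned-off Cayley graph $\hat\Gamma(G,\mathcal{P},S)$ has vertex set $G\cup G/\mathcal{P}$ and edges $\{g,gs\}$ for $g\in G$, $s\in S$, and $\{x,gP\}$ for $g\in G$, $P\in\mathcal{P}$, $x\in gP$. Vertices $gP$ are cone vertices. A graph $\Gamma$ is fine at a vertex $v$ if the set $T_v\Gamma$ of vertices adjacent to $v$, with the metric $\angle_v(x,y)$ = length of a shortest path from $x$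 to $y$ in $\Gamma\setminus\{v\}$ ($\infty$ if none), is locally finite (balls of finite radius are finite). $\mathcal{P}\hookrightarrow_h(G,S)$ means that $\hat\Gamma(G,\mathcal{P},S)$ is a connected (Gromov) hyperbolic graph that is fine at every cone vertex. *)

theory Defs
  imports "Graph_Theory.Graph_Theory" "HOL-Algebra.Group_Action" "HOL-Algebra.Generated_Groups"
    "HOL-Algebra.Left_Coset"
begin

section \<open>Groups\<close>

definition finitely_generated :: "('a, 'm) monoid_scheme \<Rightarrow> bool" where
  "finitely_generated G \<longleftrightarrow>
    (\<exists>X. finite X \<and> X \<subseteq> carrier G \<and> generate G X = carrier G)"

definition semidirect ::
  "('a, 'm) monoid_scheme \<Rightarrow> ('k, 'n) monoid_scheme \<Rightarrow> ('k \<Rightarrow> 'a \<Rightarrow> 'a) \<Rightarrow> ('a \<times> 'k) monoid" where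
  "semidirect A K \<phi> =
    \<lparr>carrier = carrier A \<times> carrier K,
     monoid.mult = (\<lambda>(a, k) (b, l). (a \<otimes>\<^bsub>A\<^esub> \<phi> k b, k \<otimes>\<^bsub>K\<^esub> l)),
     one = (\<one>\<^bsub>A\<^esub>, \<one>\<^bsub>K\<^esub>)\<rparr>"

lemma group_semidirect:
  assumes "group A" "group K" and \<phi>: "\<phi> \<in> hom K (AutoGroup A)"
  shows "group (semidirect A K \<phi>)"
proof -
  interpret A: group A by fact
  interpret K: group K by fact
  have au: "\<phi> k \<in> auto A" if "k \<in> carrier K" for k
    using \<phi> that by (auto simp: hom_def AutoGroup_def)
  have cl: "\<phi> k a \<in> carrier A" if "k \<in> carrier K" "a \<in> carrier A" for k a
    using au[OF that(1)] that(2) by (auto simp: auto_def hom_def)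
  have hm: "\<phi> k (a \<otimes>\<^bsub>A\<^esub> b) = \<phi> k a \<otimes>\<^bsub>A\<^esub> \<phi> k b"
    if "k \<in> carrier K" "a \<in> carrier A" "b \<in> carrier A" for k a b
    using au[OF that(1)] that by (auto simp: auto_def hom_def)
  have comp: "\<phi> (k \<otimes>\<^bsub>K\<^esub> l) a = \<phi> k (\<phi> l a)"
    if "k \<in> carrier K" "l \<in> carrier K" "a \<in> carrier A" for k l a
  proof -
    have "\<phi> (k \<otimes>\<^bsub>K\<^esub> l) = compose (carrier A) (\<phi> k) (\<phi> l)"
      using \<phi> au[OF that(1)] au[OF that(2)] that
      by (auto simp: hom_def AutoGroup_def BijGroup_def auto_def)
    then show ?thesis using that(3) by (simp add: compose_eq)
  qed
  have "\<phi> \<one>\<^bsub>K\<^esub> = \<one>\<^bsub>AutoGroup A\<^esub>"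
    using hom_one[OF \<phi> \<open>group K\<close> A.AutoGroup] .
  then have one: "\<phi> \<one>\<^bsub>K\<^esub> a = a" if "a \<in> carrier A" for a
    using that by (simp add: AutoGroup_def BijGroup_def)
  show ?thesis
  proof (rule groupI)
    fix x assume "x \<in> carrier (semidirect A K \<phi>)"
    then obtain a k where x: "x = (a, k)" "a \<in> carrier A" "k \<in> carrier K"
      by (auto simp: semidirect_def)
    let ?y = "(\<phi> (inv\<^bsub>K\<^esub> k) (inv\<^bsub>A\<^esub> a), inv\<^bsub>K\<^esub> k)"
    have "?y \<otimes>\<^bsub>semidirect A K \<phi>\<^esub> x = \<one>\<^bsub>semidirect A K \<phi>\<^esub>"
      using x hm[of "inv\<^bsub>K\<^esub> k" "inv\<^bsub>A\<^esub> a" a, symmetric]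
        au[of "inv\<^bsub>K\<^esub> k"]
      by (auto simp: semidirect_def auto_def intro!: hom_one[of _ A A] assms)
    moreover have "?y \<in> carrier (semidirect A K \<phi>)"
      using x cl by (auto simp: semidirect_def)
    ultimately show "\<exists>y\<in>carrier (semidirect A K \<phi>).
        y \<otimes>\<^bsub>semidirect A K \<phi>\<^esub> x = \<one>\<^bsub>semidirect A K \<phi>\<^esub>"
      by blast
  qed (auto simp: semidirect_def cl hm comp one A.m_assoc K.m_assoc)
qed

text \<open>
  The semidirect product for the natural action of a subgroup \<open>F\<close> of \<open>AutoGroup A\<close>, and
  the canonical copies of \<open>A\<close> and \<open>F\<close> in it.
\<close>

definition natural_semidirect ::
  "('a, 'm) monoid_scheme \<Rightarrow> ('a \<Rightarrow> 'a) set \<Rightarrow> ('a \<times> ('a \<Rightarrow> 'a)) monoid" where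
  "natural_semidirect A F = semidirect A ((AutoGroup A)\<lparr>carrier := F\<rparr>) (\<lambda>f. f)"

definition base_emb :: "('a, 'm) monoid_scheme \<Rightarrow> 'a \<Rightarrow> 'a \<times> ('a \<Rightarrow> 'a)" where
  "base_emb A a = (a, \<one>\<^bsub>AutoGroup A\<^esub>)"

definition aut_emb :: "('a, 'm) monoid_scheme \<Rightarrow> ('a \<Rightarrow> 'a) \<Rightarrow> 'a \<times> ('a \<Rightarrow> 'a)" where
  "aut_emb A f = (\<one>\<^bsub>A\<^esub>, f)"

lemma group_natural_semidirect:
  assumes "group A" "subgroup F (AutoGroup A)"
  shows "group (natural_semidirect A F)"
proof -
  have "(\<lambda>f. f) \<in> hom ((AutoGroup A)\<lparr>carrier := F\<rparr>) (AutoGroup A)"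
    using subgroup.subset[OF assms(2)] by (auto simp: hom_def)
  then show ?thesis
    unfolding natural_semidirect_def
    using group_semidirect[OF assms(1)] assms
      subgroup.subgroup_is_group[OF assms(2) group.AutoGroup[OF assms(1)]] by blast
qed

definition orbit_representatives ::
  "('g, 'm) monoid_scheme \<Rightarrow> 'x set \<Rightarrow> ('g \<Rightarrow> 'x \<Rightarrow> 'x) \<Rightarrow> 'x set \<Rightarrow> bool" where
  "orbit_representatives G E \<phi> R \<longleftrightarrow>
    R \<subseteq> E \<and> (\<forall>B \<in> orbits G E \<phi>. \<exists>!x. x \<in> R \<inter> B)"


section \<open>Graphs\<close>

text \<open>
  Undirected graphs are symmetric digraphs.  The distance is the combinatorial path metric on
  vertices; it is infinite between vertices that no walk joins.
\<close>

definition graph_dist :: "('v, 'e) pre_digraph \<Rightarrow> 'v \<Rightarrow> 'v \<Rightarrow> ereal" where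
  "graph_dist \<Gamma> u v = wf_digraph.\<mu> \<Gamma> (\<lambda>_. 1) u v"

definition geodesic :: "('v, 'e) pre_digraph \<Rightarrow> 'v \<Rightarrow> 'e list \<Rightarrow> 'v \<Rightarrow> bool" where
  "geodesic \<Gamma> u p v \<longleftrightarrow>
    pre_digraph.awalk \<Gamma> u p v \<and> ereal (real (length p)) = graph_dist \<Gamma> u v"

text \<open>
  Gromov hyperbolicity in the form of uniformly slim geodesic triangles.  The sides are walks
  \<open>x \<rightarrow> y \<rightarrow> z \<rightarrow> x\<close>, so the condition on the first side, for all triangles, covers the other two.
\<close>

definition hyperbolic_graph :: "('v, 'e) pre_digraph \<Rightarrow> bool" where
  "hyperbolic_graph \<Gamma> \<longleftrightarrow>
    (\<exists>\<delta>::real. \<forall>x y z p q r.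
      geodesic \<Gamma> x p y \<and> geodesic \<Gamma> y q z \<and> geodesic \<Gamma> z r x \<longrightarrow>
      (\<forall>u \<in> set (pre_digraph.awalk_verts \<Gamma> x p).
        \<exists>w \<in> set (pre_digraph.awalk_verts \<Gamma> y q) \<union> set (pre_digraph.awalk_verts \<Gamma> z r).
          graph_dist \<Gamma> u w \<le> ereal \<delta>))"

definition adjacent_verts :: "('v, 'e) pre_digraph \<Rightarrow> 'v \<Rightarrow> 'v set" where
  "adjacent_verts \<Gamma> v = {x. v \<rightarrow>\<^bsub>\<Gamma>\<^esub> x}"

definition angle_dist :: "('v, 'e) pre_digraph \<Rightarrow> 'v \<Rightarrow> 'v \<Rightarrow> 'v \<Rightarrow> ereal" where
  "angle_dist \<Gamma> v x y = graph_dist (pre_digraph.del_vert \<Gamma> v) x y"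

definition fine_at :: "('v, 'e) pre_digraph \<Rightarrow> 'v \<Rightarrow> bool" where
  "fine_at \<Gamma> v \<longleftrightarrow>
    (\<forall>x \<in> adjacent_verts \<Gamma> v. \<forall>n::real.
      finite {y \<in> adjacent_verts \<Gamma> v. angle_dist \<Gamma> v x y \<le> ereal n})"


section \<open>Coned-off Cayley graphs and hyperbolically embedded collections\<close>

definition left_cosets :: "('a, 'm) monoid_scheme \<Rightarrow> 'a set set \<Rightarrow> 'a set set" where
  "left_cosets G \<P> = (\<Union>P\<in>\<P>. lcosets\<^bsub>G\<^esub> P)"

text \<open>
  Group elements are tagged with \<open>Inl\<close> and cone vertices with \<open>Inr\<close>; every edge is present in
  both directions.  If \<open>S\<close> contains the identity, there are loops at group elements, which affect
  neither distances nor fineness at cone vertices.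
\<close>

definition coned_off_cayley ::
  "('a, 'm) monoid_scheme \<Rightarrow> 'a set set \<Rightarrow> 'a set \<Rightarrow>
    ('a + 'a set, ('a + 'a set) \<times> ('a + 'a set)) pre_digraph" where
  "coned_off_cayley G \<P> S = with_proj
    \<lparr>pverts = Inl ` carrier G \<union> Inr ` left_cosets G \<P>,
     parcs = symcl
       ({(Inl g, Inl (g \<otimes>\<^bsub>G\<^esub> s)) | g s. g \<in> carrier G \<and> s \<in> S}
        \<union> {(Inl x, Inr C) | x C. C \<in> left_cosets G \<P> \<and> x \<in> C})\<rparr>"

lemma sym_digraph_coned_off_cayley:
  assumes "group G" "\<And>P. P \<in> \<P> \<Longrightarrow> subgroup P G" "S \<subseteq> carrier G"
  shows "sym_digraph (coned_off_cayley G \<P> S)"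
proof -
  interpret group G by fact
  have C: "x \<in> carrier G" if "C \<in> left_cosets G \<P>" "x \<in> C" for x C
    using that subgroup.lcosets_carrier[OF assms(2) assms(1)] by (auto simp: left_cosets_def)
  have S: "s \<in> carrier G" if "s \<in> S" for s
    using that assms(3) by blast
  have "sym (symcl R)" for R :: "('a + 'a set) rel"
    by (auto simp: sym_def symcl_def image_iff)
  then show ?thesis
    by unfold_locales
      (auto simp: coned_off_cayley_def symmetric_def, auto simp: symcl_def intro: C S)
qed

definition hyperbolically_embedded ::
  "('a, 'm) monoid_scheme \<Rightarrow> 'a set set \<Rightarrow> 'a set \<Rightarrow> bool" where
  "hyperbolically_embedded G \<P> S \<longleftrightarrow>
    (\<forall>P \<in> \<P>. subgroup P G \<and> infinite P) \<and> S \<subseteq> carrier G \<and>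
    Digraph_Component.connected (coned_off_cayley G \<P> S) \<and>
    hyperbolic_graph (coned_off_cayley G \<P> S) \<and>
    (\<forall>C \<in> left_cosets G \<P>. fine_at (coned_off_cayley G \<P> S) (Inr C))"

end

theory Submission
  imports Defs
begin

text \<open>
  Forgetting the \<open>F\<close>-coordinate projects the coned-off Cayley graph of \<open>A \<rtimes> F\<close> onto that of
  \<open>A\<close>. The former consists of one copy of the Cayley graph of \<open>A\<close> for every \<open>f \<in> F\<close>, the
  \<open>f\<close>-layer \<open>A \<times> {f}\<close>, because \<open>T\<close> is invariant; the generators from \<open>F\<close> join all copies of
  the same element of \<open>A\<close> to each other. A coset of \<open>K \<in> \<H>F\<close> lies in a single layer:
  \<open>(a, f) K = a f(K) \<times> {f}\<close>. Since \<open>F\<close> acts freely on \<open>\<H>\<close>, every member of \<open>\<H>\<close> is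
  \<open>f(K)\<close> for exactly one pair of \<open>f \<in> F\<close> and \<open>K \<in> \<H>F\<close>, and a coset determines its subgroup,
  so the projection is a bijection on cone vertices (\<open>coset_unique\<close>, \<open>coset_lift\<close>): every cone
  vertex of \<open>A\<close> is present, but in one layer only.

  Fineness follows at once (\<open>fine_at_by_projection\<close>): the projection does not lengthen walks, a
  walk that avoids a cone vertex is projected to a walk that avoids its image, and the
  neighbours of a cone vertex lie in one layer, where the projection is injective.

  In the other direction, an edge lifts to a walk of length at most 2, a change of layer being
  needed before some cone vertices, and two vertices with the same image are joined by an edge
  or equal. Hence \<open>d(\<pi> x, \<pi> y) \<le> d'(x, y) \<le> 2 d(\<pi> x, \<pi> y) + 2\<close>, which gives
  connectedness, and the projection is a quasi-isometry. This suffices for hyperbolicity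
  (\<open>slim_pullback\<close>), but it does not preserve geodesics, so the stability of quasi-geodesics in
  hyperbolic graphs (Morse lemma) is needed. Its proof is the classical one: a geodesic stays
  logarithmically close to any curve with the same ends (\<open>geodesic_near_chain\<close>), which for a
  quasi-geodesic bounds the distance altogether (\<open>geodesic_near_quasi_geodesic\<close>), and a
  connectedness argument gives the converse (\<open>quasi_geodesic_near_geodesic\<close>).
\<close>

section \<open>Connected graphs as metric spaces\<close>

locale connected_graph =
  fixes V :: "'v set" and R :: "'v rel"
  assumes edges_in: "R \<subseteq> V \<times> V"
    and sym_edges: "sym R"
    and joined: "u \<in> V \<Longrightarrow> v \<in> V \<Longrightarrow> (u, v) \<in> R\<^sup>*"
begin

definition hdist :: "'v \<Rightarrow> 'v \<Rightarrow> nat" where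
  "hdist u v = (LEAST n. (u, v) \<in> R ^^ n)"

lemma hdist_relpow: "u \<in> V \<Longrightarrow> v \<in> V \<Longrightarrow> (u, v) \<in> R ^^ hdist u v"
  unfolding hdist_def using joined[of u v] by (auto simp: rtrancl_power intro: LeastI_ex)

lemma hdist_le: "(u, v) \<in> R ^^ n \<Longrightarrow> hdist u v \<le> n"
  unfolding hdist_def by (rule Least_le)

lemma hdist_self [simp]: "hdist u u = 0"
  using hdist_le[of u u 0] by simp

lemma hdist_eq_0: "u \<in> V \<Longrightarrow> v \<in> V \<Longrightarrow> hdist u v = 0 \<Longrightarrow> u = v"
  using hdist_relpow[of u v] by simp

lemma hdist_commute: "hdist u v = hdist v u"
proof -
  have "(x, y) \<in> R ^^ n \<Longrightarrow> (y, x) \<in> R ^^ n" for x y n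
  proof (induction n arbitrary: y)
    case (Suc n)
    then obtain z where "(x, z) \<in> R ^^ n" "(z, y) \<in> R" by auto
    then show ?case using Suc.IH symD[OF sym_edges] by (blast intro: relpow_Suc_I2)
  qed auto
  then have "(x, y) \<in> R ^^ n \<longleftrightarrow> (y, x) \<in> R ^^ n" for x y n by blast
  then show ?thesis unfolding hdist_def by simp
qed

lemma hdist_triangle:
  assumes "u \<in> V" "v \<in> V" "w \<in> V"
  shows "hdist u w \<le> hdist u v + hdist v w"
  using assms hdist_relpow[of u v] hdist_relpow[of v w]
  by (intro hdist_le) (auto simp: relpow_add)

definition geod :: "(nat \<Rightarrow> 'v) \<Rightarrow> 'v \<Rightarrow> 'v \<Rightarrow> bool" where
  "geod g x y \<longleftrightarrow> x \<in> V \<and> y \<in> V \<and> g 0 = x \<and> g (hdist x y) = y \<and> (\<forall>i\<le>hdist x y. g i \<in> V) \<and>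
    (\<forall>i j. i \<le> j \<longrightarrow> j \<le> hdist x y \<longrightarrow> hdist (g i) (g j) = j - i)"

lemma geodD:
  assumes "geod g x y"
  shows "x \<in> V" "y \<in> V" "g 0 = x" "g (hdist x y) = y" "i \<le> hdist x y \<Longrightarrow> g i \<in> V"
    "i \<le> j \<Longrightarrow> j \<le> hdist x y \<Longrightarrow> hdist (g i) (g j) = j - i"
  using assms unfolding geod_def by auto

lemma relpow_segment:
  assumes "\<forall>i<n. (g i, g (Suc i)) \<in> R" "i \<le> j" "j \<le> n"
  shows "(g i, g j) \<in> R ^^ (j - i)"
proof -
  have "\<exists>f. f 0 = g i \<and> f (j - i) = g j \<and> (\<forall>k<j - i. (f k, f (Suc k)) \<in> R)"
    using assms by (intro exI[of _ "\<lambda>k. g (i + k)"]) auto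
  then show ?thesis by (simp add: relpow_fun_conv)
qed

text \<open>A walk whose length is the distance of its ends cannot make a detour in between.\<close>

lemma geod_if_edges:
  assumes x: "x \<in> V" and y: "y \<in> V" and g: "g 0 = x" "g (hdist x y) = y"
    and e: "\<forall>i<hdist x y. (g i, g (Suc i)) \<in> R"
  shows "geod g x y"
proof -
  let ?n = "hdist x y"
  have V: "g i \<in> V" if "i \<le> ?n" for i
    using that e edges_in x g(1) by (cases i) (auto simp: less_eq_Suc_le)
  have "hdist (g i) (g j) = j - i" if ij: "i \<le> j" "j \<le> ?n" for i j
  proof -
    have le: "hdist (g a) (g b) \<le> b - a" if "a \<le> b" "b \<le> ?n" for a b
      using relpow_segment[OF e that] by (rule hdist_le)
    have "?n \<le> hdist (g 0) (g i) + hdist (g i) (g ?n)"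
      using hdist_triangle[OF x V[of i] y] ij g by simp
    also have "hdist (g i) (g ?n) \<le> hdist (g i) (g j) + hdist (g j) (g ?n)"
      using hdist_triangle[OF V[of i] V[of j] V[of ?n]] ij by simp
    finally show ?thesis using le[of 0 i] le[of j ?n] le[of i j] ij by simp
  qed
  then show ?thesis unfolding geod_def using x y g V by blast
qed

lemma geod_edges:
  assumes "geod g x y" "i < hdist x y"
  shows "(g i, g (Suc i)) \<in> R"
proof -
  have "hdist (g i) (g (Suc i)) = 1" using geodD(6)[OF assms(1), of i "Suc i"] assms(2) by simp
  then show ?thesis
    using hdist_relpow[of "g i" "g (Suc i)"] geodD(5)[OF assms(1)] assms(2) by simp
qed

lemma geod_exists:
  assumes "x \<in> V" "y \<in> V"
  obtains g where "geod g x y"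
  using hdist_relpow[OF assms] geod_if_edges[OF assms] by (auto simp: relpow_fun_conv)

lemma geod_reverse:
  assumes "geod g x y"
  shows "geod (\<lambda>i. g (hdist x y - i)) y x"
proof -
  have "hdist (g (hdist x y - i)) (g (hdist x y - j)) = j - i" if "i \<le> j" "j \<le> hdist x y" for i j
    using geodD(6)[OF assms, of "hdist x y - j" "hdist x y - i"] that
    by (simp add: hdist_commute)
  then show ?thesis
    unfolding geod_def using geodD[OF assms] by (simp add: hdist_commute[of y x])
qed

lemma geod_sub:
  assumes g: "geod g x y" and pq: "p \<le> q" "q \<le> hdist x y"
  shows "geod (\<lambda>i. g (p + i)) (g p) (g q)" "hdist (g p) (g q) = q - p"
  using geodD[OF g] pq unfolding geod_def by auto

text \<open>
  The two other sides form a route from \<open>x\<close> through \<open>z\<close> to \<open>y\<close>, so that subdividing a chain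
  from \<open>x\<close> to \<open>y\<close> at \<open>z\<close> produces sides with the right orientation.
\<close>

definition slim :: "nat \<Rightarrow> bool" where
  "slim \<delta> \<longleftrightarrow> (\<forall>x y z g h k i. geod g x y \<longrightarrow> geod h x z \<longrightarrow> geod k z y \<longrightarrow> i \<le> hdist x y \<longrightarrow>
     (\<exists>j\<le>hdist x z. hdist (g i) (h j) \<le> \<delta>) \<or> (\<exists>j\<le>hdist z y. hdist (g i) (k j) \<le> \<delta>))"

section \<open>Chains and slim triangles\<close>

text \<open>
  Chains may pause, so that the projection of an edge path and the concatenation of chains
  with a common end are chains again.
\<close>

definition chain :: "'v list \<Rightarrow> bool" where
  "chain xs \<longleftrightarrow> xs \<noteq> [] \<and> set xs \<subseteq> V \<and> successively (\<lambda>u v. hdist u v \<le> 1) xs"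

lemma chain_append:
  assumes "chain xs" "chain ys" "last xs = hd ys"
  shows "chain (xs @ ys)"
  using assms unfolding chain_def by (auto simp: successively_append_iff)

lemma chain_rev: "chain xs \<Longrightarrow> chain (rev xs)"
  unfolding chain_def by (auto simp: hdist_commute)

lemma chain_map:
  assumes "a \<le> b" "\<And>i. a \<le> i \<Longrightarrow> i \<le> b \<Longrightarrow> c i \<in> V"
    "\<And>i. a \<le> i \<Longrightarrow> i < b \<Longrightarrow> hdist (c i) (c (Suc i)) \<le> 1"
  shows "chain (map c [a..<Suc b])"
  using assms unfolding chain_def
  by (auto simp: successively_conv_nth nth_append simp del: upt_Suc)

lemma chain_between:
  assumes "x \<in> V" "y \<in> V"
  obtains xs where "chain xs" "hd xs = x" "last xs = y" "length xs = hdist x y + 1"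
    "\<And>w. w \<in> set xs \<Longrightarrow> hdist x w \<le> hdist x y"
proof -
  obtain g where g: "geod g x y" using geod_exists[OF assms] .
  show ?thesis
  proof (rule that[of "map g [0..<Suc (hdist x y)]"])
    show "chain (map g [0..<Suc (hdist x y)])"
      using geodD(5,6)[OF g] by (intro chain_map) auto
    show "hdist x w \<le> hdist x y" if "w \<in> set (map g [0..<Suc (hdist x y)])" for w
      using that geodD(6)[OF g, of 0] geodD(3)[OF g] by auto
  qed (use geodD[OF g] in \<open>auto simp: hd_map hd_upt simp del: upt_Suc\<close>, auto)
qed

text \<open>
  Halving a chain replaces a geodesic between its ends by the two other sides of a triangle and
  costs one slimness constant, so a geodesic stays within a logarithm of the length of any chain
  with the same ends.
\<close>

lemma geodesic_near_chain:
  assumes "slim \<delta>"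
  shows "chain xs \<Longrightarrow> length xs \<le> 2 ^ N + 1 \<Longrightarrow> geod g (hd xs) (last xs) \<Longrightarrow>
    i \<le> hdist (hd xs) (last xs) \<Longrightarrow> \<exists>w\<in>set xs. hdist (g i) w \<le> \<delta> * N"
proof (induction N arbitrary: xs g i)
  case 0
  have ne: "xs \<noteq> []" using 0(1) by (simp add: chain_def)
  have "hdist (hd xs) (last xs) \<le> 1"
  proof (cases xs)
    case (Cons a ys)
    then show ?thesis using 0(1,2) by (cases ys) (auto simp: chain_def)
  qed (use ne in simp)
  then have "i = 0 \<or> i = hdist (hd xs) (last xs)" using 0(4) by auto
  then have "g i = hd xs \<or> g i = last xs" using geodD(3,4)[OF 0(3)] by auto
  then show ?case using ne hd_in_set last_in_set by (metis bot_nat_0.extremum hdist_self)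
next
  case (Suc N)
  show ?case
  proof (cases "length xs \<le> 2 ^ N + 1")
    case True
    then obtain w where "w \<in> set xs" "hdist (g i) w \<le> \<delta> * N"
      using Suc by blast
    then show ?thesis by (intro bexI[of _ w]) auto
  next
    case False
    define m where "m = (2::nat) ^ N"
    define ys zs where "ys = take (Suc m) xs" and "zs = drop m xs"
    have len: "m + 1 < length xs" "length xs \<le> m + m + 1"
      using False Suc.prems(2) by (auto simp: m_def)
    have ne: "xs \<noteq> []" using len by auto
    have ch: "chain ys" "chain zs"
      using Suc.prems(1) len set_take_subset[of "Suc m" xs] set_drop_subset[of m xs]
      unfolding chain_def ys_def zs_def
      by (auto simp: successively_conv_nth)
    have ends: "hd ys = hd xs" "last ys = xs ! m" "hd zs = xs ! m" "last zs = last xs"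
      using len ne unfolding ys_def zs_def
      by (auto simp: hd_drop_conv_nth last_conv_nth)
    have V: "hd xs \<in> V" "last xs \<in> V" "xs ! m \<in> V"
      using Suc.prems(1) len ne unfolding chain_def by (auto simp: subset_iff)
    obtain h where h: "geod h (hd xs) (xs ! m)" using geod_exists V by blast
    obtain k where k: "geod k (xs ! m) (last xs)" using geod_exists V by blast
    have near: "\<exists>w\<in>set xs. hdist v w \<le> \<delta> * N"
      if "(\<exists>j\<le>hdist (hd xs) (xs ! m). v = h j) \<or> (\<exists>j\<le>hdist (xs ! m) (last xs). v = k j)" for v
      using that
    proof (elim disjE exE conjE)
      fix j assume j: "j \<le> hdist (hd xs) (xs ! m)" "v = h j"
      have "\<exists>w\<in>set ys. hdist (h j) w \<le> \<delta> * N"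
        by (rule Suc.IH[OF ch(1)]) (use h j len in \<open>auto simp: ends ys_def[symmetric]\<close>,
          simp add: ys_def m_def)
      then show ?thesis using j set_take_subset[of "Suc m" xs] unfolding ys_def by blast
    next
      fix j assume j: "j \<le> hdist (xs ! m) (last xs)" "v = k j"
      have "\<exists>w\<in>set zs. hdist (k j) w \<le> \<delta> * N"
        by (rule Suc.IH[OF ch(2)]) (use k j len in \<open>auto simp: ends zs_def[symmetric]\<close>,
          simp add: zs_def m_def)
      then show ?thesis using j set_drop_subset[of m xs] unfolding zs_def by blast
    qed
    have "(\<exists>j\<le>hdist (hd xs) (xs ! m). hdist (g i) (h j) \<le> \<delta>)
        \<or> (\<exists>j\<le>hdist (xs ! m) (last xs). hdist (g i) (k j) \<le> \<delta>)"
      using assms Suc.prems(3,4) h k unfolding slim_def by blast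
    then obtain v where v: "v \<in> V" "hdist (g i) v \<le> \<delta>"
      "(\<exists>j\<le>hdist (hd xs) (xs ! m). v = h j) \<or> (\<exists>j\<le>hdist (xs ! m) (last xs). v = k j)"
      using geodD(5)[OF h] geodD(5)[OF k] by blast
    obtain w where w: "w \<in> set xs" "hdist v w \<le> \<delta> * N" using near[OF v(3)] by blast
    have "hdist (g i) w \<le> hdist (g i) v + hdist v w"
      using v w Suc.prems geodD(5)[OF Suc.prems(3)]
      by (intro hdist_triangle) (auto simp: chain_def)
    also have "\<dots> \<le> \<delta> * Suc N" using v w by simp
    finally show ?thesis using w by blast
  qed
qed

section \<open>Stability of quasi-geodesics\<close>

definition quasi_geod :: "nat \<Rightarrow> (nat \<Rightarrow> 'v) \<Rightarrow> nat \<Rightarrow> bool" where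
  "quasi_geod K c n \<longleftrightarrow> (\<forall>i\<le>n. c i \<in> V) \<and> (\<forall>i<n. hdist (c i) (c (Suc i)) \<le> 1) \<and>
     (\<forall>i j. i \<le> j \<longrightarrow> j \<le> n \<longrightarrow> j - i \<le> K * hdist (c i) (c j) + K)"

lemma quasi_geodD:
  assumes "quasi_geod K c n"
  shows "i \<le> n \<Longrightarrow> c i \<in> V" "i < n \<Longrightarrow> hdist (c i) (c (Suc i)) \<le> 1"
    "i \<le> j \<Longrightarrow> j \<le> n \<Longrightarrow> j - i \<le> K * hdist (c i) (c j) + K"
  using assms unfolding quasi_geod_def by auto

lemma quasi_geod_lipschitz:
  assumes c: "quasi_geod K c n"
  shows "i \<le> j \<Longrightarrow> j \<le> n \<Longrightarrow> hdist (c i) (c j) \<le> j - i"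
proof (induction j rule: dec_induct)
  case (step j)
  have "hdist (c i) (c (Suc j)) \<le> hdist (c i) (c j) + hdist (c j) (c (Suc j))"
    using step quasi_geodD(1)[OF c] by (intro hdist_triangle) auto
  then show ?case using step quasi_geodD(2)[OF c, of j] by simp
qed simp

lemma quasi_geod_chain:
  assumes c: "quasi_geod K c n" and ab: "a \<le> n" "b \<le> n"
  obtains xs where "chain xs" "hd xs = c a" "last xs = c b" "set xs \<subseteq> c ` {..n}"
    "length xs \<le> K * hdist (c a) (c b) + K + 1"
proof -
  have *: "\<exists>xs. chain xs \<and> hd xs = c a \<and> last xs = c b \<and> set xs \<subseteq> c ` {..n}
      \<and> length xs \<le> K * hdist (c a) (c b) + K + 1" if "a \<le> b" "b \<le> n" for a b
  proof (intro exI[of _ "map c [a..<Suc b]"] conjI)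
    show "chain (map c [a..<Suc b])"
      using quasi_geodD(1,2)[OF c] that by (intro chain_map) auto
    show "length (map c [a..<Suc b]) \<le> K * hdist (c a) (c b) + K + 1"
      using quasi_geodD(3)[OF c that] that by simp
  qed (use that in \<open>auto simp: hd_map hd_upt simp del: upt_Suc\<close>, auto)
  show ?thesis
  proof (cases "a \<le> b")
    case True
    then show ?thesis using * ab that by blast
  next
    case False
    then obtain xs where "chain xs" "hd xs = c b" "last xs = c a" "set xs \<subseteq> c ` {..n}"
      "length xs \<le> K * hdist (c b) (c a) + K + 1"
      using *[of b a] ab by auto
    then show ?thesis
      by (intro that[of "rev xs"])
        (auto simp: chain_rev hd_rev last_rev hdist_commute[of "c a"])
  qed
qed

end

lemma linear_le_exp:
  fixes a b :: nat
  obtains M where "\<And>N. M \<le> N \<Longrightarrow> a * N + b \<le> 2 ^ N"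
proof -
  \<comment> \<open>\<open>2 * k\<close> works: \<open>a * (2 * k) + b \<le> k * k \<le> 2 ^ k * 2 ^ k\<close>, and each further step adds
      \<open>a \<le> 2 ^ N\<close> on the left and \<open>2 ^ N\<close> on the right.\<close>
  define k where "k = 2 * a + b + 1"
  have "a * N + b \<le> 2 ^ N \<and> a \<le> 2 ^ N" if "2 * k \<le> N" for N
    using that
  proof (induction N rule: dec_induct)
    case base
    have "k \<le> 2 ^ k" using less_exp[of k] by simp
    then have "k * k \<le> 2 ^ k * 2 ^ k" by (rule mult_le_mono) simp
    moreover have "a * (2 * k) + b \<le> k * k" "a \<le> k * k" unfolding k_def by (auto simp: algebra_simps)
    ultimately show ?case by (simp add: power_add mult_2)
  qed auto
  then show ?thesis using that by blast
qed

text \<open>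
  If \<open>\<delta> > 0\<close>, choose for large \<open>D\<close> a number \<open>N\<close> such that \<open>D\<close> is just above \<open>\<delta> * N\<close>: then \<open>a * D + b\<close> is at
  most a linear function of \<open>N\<close>, hence below \<open>2 ^ N\<close>, and the hypothesis on \<open>D\<close> is violated.
  If \<open>\<delta> = 0\<close>, any large \<open>N\<close> forces \<open>D = 0\<close>.
\<close>

lemma bounded_if_le_log:
  fixes \<delta> a b :: nat
  obtains B where "\<And>D. (\<And>N. a * D + b \<le> 2 ^ N \<Longrightarrow> D \<le> \<delta> * N) \<Longrightarrow> D \<le> B"
proof -
  obtain M where M: "\<And>N. M \<le> N \<Longrightarrow> (a * \<delta>) * N + (a * \<delta> + b) \<le> 2 ^ N"
    using linear_le_exp by blast
  show ?thesis
  proof (rule that[of "\<delta> * M"], rule ccontr)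
    fix D assume D: "\<And>N. a * D + b \<le> 2 ^ N \<Longrightarrow> D \<le> \<delta> * N" and "\<not> D \<le> \<delta> * M"
    then have big: "\<delta> * M < D" by simp
    show False
    proof (cases "\<delta> = 0")
      case True
      have "a * D + b \<le> 2 ^ (a * D + b)" using less_exp[of "a * D + b"] by simp
      then show False using D big True by fastforce
    next
      case False
      define N where "N = (D - 1) div \<delta>"
      have D1: "\<delta> * N < D" "D \<le> \<delta> * N + \<delta>"
        using big False mod_less_divisor[of \<delta> "D - 1"] mult_div_mod_eq[of \<delta> "D - 1"]
        unfolding N_def by linarith+
      have "M \<le> N" unfolding N_def using big False
        by (simp add: less_eq_div_iff_mult_less_eq mult.commute)
      have "a * D \<le> a * (\<delta> * N + \<delta>)" using D1(2) by (rule mult_le_mono2)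
      then have "a * D + b \<le> 2 ^ N" using M[OF \<open>M \<le> N\<close>] by (simp add: algebra_simps)
      then show False using D D1(1) by fastforce
    qed
  qed
qed

context connected_graph begin

text \<open>
  Let \<open>g s\<close> be a point of the geodesic at the maximal distance \<open>D\<close> from the curve. Leave the
  geodesic at distance \<open>2 * D\<close> from \<open>g s\<close> on both sides (or at its ends, if these are nearer),
  go to the curve by paths of length at most \<open>D\<close> and follow the curve. This detour avoids the
  open ball of radius \<open>D\<close> around \<open>g s\<close>, but as the curve is a quasi-geodesic, its length is
  linear in \<open>D\<close>, so \<open>geodesic_near_chain\<close> bounds \<open>D\<close> by a logarithm of \<open>D\<close>.
\<close>

lemma geodesic_far_from_curve_bound:
  assumes slim: "slim \<delta>" and c: "quasi_geod K c n" and g: "geod g (c 0) (c n)"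
    and s: "s \<le> hdist (c 0) (c n)"
    and far: "\<And>k. k \<le> n \<Longrightarrow> D \<le> hdist (g s) (c k)"
    and cover: "\<And>t. t \<le> hdist (c 0) (c n) \<Longrightarrow> \<exists>k\<le>n. hdist (g t) (c k) \<le> D"
    and N: "(6 * K + 2) * D + (K + 2) \<le> 2 ^ N"
  shows "D \<le> \<delta> * N"
proof -
  let ?m = "hdist (c 0) (c n)"
  note cV = quasi_geodD(1)[OF c] and gV = geodD(5)[OF g]
  have escape: "D \<le> hdist (g s) w"
    if "w \<in> V" "p \<le> ?m" "hdist (g s) (g p) = 2 * D" "hdist (g p) w \<le> D" for w p
    using that hdist_triangle[of "g s" w "g p"] gV[of p] gV[OF s] hdist_commute[of w "g p"] by simp
  \<comment> \<open>Points \<open>w\<close> on a shortest path from \<open>g p\<close> to \<open>c a\<close> are recorded by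
      \<open>hdist (g p) w \<le> hdist (g p) (c a)\<close> only; at an end of \<open>g\<close> this path is trivial.\<close>
  obtain p a where p: "p \<le> s" "s - p \<le> 2 * D" and a: "a \<le> n" "hdist (g p) (c a) \<le> D"
    and left: "\<And>w. w \<in> V \<Longrightarrow> hdist (g p) w \<le> hdist (g p) (c a) \<Longrightarrow> D \<le> hdist (g s) w"
  proof (cases "2 * D \<le> s")
    case True
    obtain a where a: "a \<le> n" "hdist (g (s - 2 * D)) (c a) \<le> D" using cover[of "s - 2 * D"] s by force
    have "hdist (g s) (g (s - 2 * D)) = 2 * D"
      using geodD(6)[OF g, of "s - 2 * D" s] s True hdist_commute[of "g s"] by simp
    then show ?thesis using a s True
      by (intro that[of "s - 2 * D" a]) (auto intro: escape[of _ "s - 2 * D"])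
  next
    case False
    have "D \<le> hdist (g s) w" if "w \<in> V" "hdist (g 0) w \<le> hdist (g 0) (c 0)" for w
      using that far[of 0] hdist_eq_0[of "c 0" w] cV[of 0] geodD(3)[OF g] by auto
    then show ?thesis using False geodD(3)[OF g] by (intro that[of 0 0]) auto
  qed
  obtain q b where q: "s \<le> q" "q \<le> ?m" "q - s \<le> 2 * D" and b: "b \<le> n" "hdist (g q) (c b) \<le> D"
    and right: "\<And>w. w \<in> V \<Longrightarrow> hdist (g q) w \<le> hdist (g q) (c b) \<Longrightarrow> D \<le> hdist (g s) w"
  proof (cases "s + 2 * D \<le> ?m")
    case True
    obtain b where b: "b \<le> n" "hdist (g (s + 2 * D)) (c b) \<le> D" using cover[OF True] by auto
    have "hdist (g s) (g (s + 2 * D)) = 2 * D"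
      using geodD(6)[OF g, of s "s + 2 * D"] True by simp
    then show ?thesis using b True
      by (intro that[of "s + 2 * D" b]) (auto intro: escape[of _ "s + 2 * D"])
  next
    case False
    have "D \<le> hdist (g s) w" if "w \<in> V" "hdist (g ?m) w \<le> hdist (g ?m) (c n)" for w
      using that far[of n] hdist_eq_0[of "c n" w] cV[of n] geodD(4)[OF g] by auto
    then show ?thesis using False s geodD(4)[OF g] by (intro that[of ?m n]) auto
  qed
  have V: "g p \<in> V" "g q \<in> V" "c a \<in> V" "c b \<in> V" "p \<le> ?m"
    using p q s a b cV gV by auto
  obtain xs where xs: "chain xs" "hd xs = g p" "last xs = c a"
    "length xs = hdist (g p) (c a) + 1" "\<And>w. w \<in> set xs \<Longrightarrow> hdist (g p) w \<le> hdist (g p) (c a)"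
    using chain_between[OF V(1,3)] by metis
  obtain zs where zs: "chain zs" "hd zs = g q" "last zs = c b"
    "length zs = hdist (g q) (c b) + 1" "\<And>w. w \<in> set zs \<Longrightarrow> hdist (g q) w \<le> hdist (g q) (c b)"
    using chain_between[OF V(2,4)] by metis
  obtain ys where ys: "chain ys" "hd ys = c a" "last ys = c b" "set ys \<subseteq> c ` {..n}"
    "length ys \<le> K * hdist (c a) (c b) + K + 1"
    using quasi_geod_chain[OF c a(1) b(1)] by metis
  define ws where "ws = xs @ ys @ rev zs"
  have ne: "xs \<noteq> []" "ys \<noteq> []" "zs \<noteq> []" using xs ys zs by (auto simp: chain_def)
  have ws: "chain ws" "hd ws = g p" "last ws = g q"
    unfolding ws_def using xs ys zs ne
    by (auto intro!: chain_append chain_rev simp: hd_rev last_rev)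
  have pq: "hdist (g p) (g q) = q - p" "geod (\<lambda>i. g (p + i)) (g p) (g q)"
    using geod_sub[OF g, of p q] p q by auto
  have "hdist (c a) (c b) \<le> hdist (c a) (g p) + hdist (g p) (c b)"
    using V by (intro hdist_triangle)
  also have "hdist (g p) (c b) \<le> hdist (g p) (g q) + hdist (g q) (c b)"
    using V by (intro hdist_triangle)
  finally have "hdist (c a) (c b) \<le> 6 * D"
    using pq(1) a(2) b(2) p q hdist_commute[of "c a"] by simp
  then have "K * hdist (c a) (c b) \<le> K * (6 * D)" by (rule mult_le_mono2)
  moreover have "(6 * K + 2) * D = K * (6 * D) + 2 * D" by (simp add: algebra_simps)
  moreover have "length ws = length xs + length ys + length zs" by (simp add: ws_def)
  ultimately have "length ws \<le> 2 ^ N + 1"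
    using xs(4) ys(5) zs(4) a(2) b(2) N by linarith
  then have "\<exists>w\<in>set ws. hdist (g (p + (s - p))) w \<le> \<delta> * N"
    using ws pq p q by (intro geodesic_near_chain[OF slim]) auto
  then obtain w where w: "w \<in> set ws" "hdist (g s) w \<le> \<delta> * N" using p by auto
  have "D \<le> hdist (g s) w"
  proof -
    have "w \<in> set xs \<or> w \<in> set ys \<or> w \<in> set zs" using w(1) by (simp add: ws_def)
    moreover have "set xs \<subseteq> V" "set zs \<subseteq> V" using xs(1) zs(1) by (auto simp: chain_def)
    ultimately show ?thesis using left[OF _ xs(5)] right[OF _ zs(5)] far ys(4) by blast
  qed
  then show ?thesis using w(2) by simp
qed

text \<open>
  Let \<open>D\<close> be least such that every point of the geodesic is within \<open>D\<close> of the curve. Then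
  \<open>geodesic_far_from_curve_bound\<close> holds for all \<open>N\<close>, so \<open>bounded_if_le_log\<close> bounds \<open>D\<close> in
  terms of \<open>\<delta>\<close> and \<open>K\<close>.
\<close>

lemma geodesic_near_quasi_geodesic:
  fixes K :: nat
  assumes slim: "slim \<delta>"
  obtains B where "\<And>c n g t. quasi_geod K c n \<Longrightarrow> geod g (c 0) (c n) \<Longrightarrow> t \<le> hdist (c 0) (c n) \<Longrightarrow>
    \<exists>k\<le>n. hdist (g t) (c k) \<le> B"
proof -
  obtain B where B: "\<And>D. (\<And>N. (6 * K + 2) * D + (K + 2) \<le> 2 ^ N \<Longrightarrow> D \<le> \<delta> * N) \<Longrightarrow> D \<le> B"
    using bounded_if_le_log by blast
  show ?thesis
  proof (rule that[of B])
    fix c n g t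
    assume c: "quasi_geod K c n" and g: "geod g (c 0) (c n)" and t: "t \<le> hdist (c 0) (c n)"
    let ?m = "hdist (c 0) (c n)"
    let ?P = "\<lambda>D. \<forall>t\<le>?m. \<exists>k\<le>n. hdist (g t) (c k) \<le> D"
    define D where "D = (LEAST D. ?P D)"
    have "hdist (g t) (c 0) \<le> ?m" if "t \<le> ?m" for t
      using that geodD(6)[OF g, of 0 t] geodD(3)[OF g] hdist_commute[of "g t"] by simp
    then have "?P ?m" by blast
    then have cover: "?P D" unfolding D_def by (rule LeastI)
    have "\<exists>s\<le>?m. \<forall>k\<le>n. D \<le> hdist (g s) (c k)"
    proof (cases D)
      case (Suc E)
      then have "\<not> ?P E" unfolding D_def by (intro not_less_Least) simp
      then show ?thesis using Suc by (meson not_less_eq_eq)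
    qed auto
    then obtain s where "s \<le> ?m" "\<And>k. k \<le> n \<Longrightarrow> D \<le> hdist (g s) (c k)" by blast
    then have "D \<le> B"
      using geodesic_far_from_curve_bound[OF slim c g] cover by (intro B) blast
    then show "\<exists>k\<le>n. hdist (g t) (c k) \<le> B" using cover t le_trans by blast
  qed
qed

text \<open>
  Along the geodesic, the nearby points of the quasi-geodesic pass at some moment from before
  to after the parameter \<open>i\<close>, possibly in a jump. The points on both sides of the jump are close
  in space, hence in parameter, and \<open>c i\<close> is between them.
\<close>

lemma quasi_geodesic_near_geodesic:
  assumes c: "quasi_geod K c n" and g: "geod g (c 0) (c n)" and i: "i \<le> n"
    and near: "\<And>t. t \<le> hdist (c 0) (c n) \<Longrightarrow> \<exists>k\<le>n. hdist (g t) (c k) \<le> B"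
  shows "\<exists>t\<le>hdist (c 0) (c n). hdist (c i) (g t) \<le> K * (2 * B + 1) + K + B"
proof -
  let ?m = "hdist (c 0) (c n)"
  note cV = quasi_geodD(1)[OF c] and gV = geodD(5)[OF g]
  let ?Q = "\<lambda>t. \<exists>k\<le>i. hdist (g t) (c k) \<le> B"
  \<comment> \<open>The last moment at which some nearby point of \<open>c\<close> is not after \<open>i\<close>.\<close>
  define t where "t = (GREATEST t. t \<le> ?m \<and> ?Q t)"
  have 0: "0 \<le> ?m \<and> ?Q 0" using geodD(3)[OF g] by auto
  have t: "t \<le> ?m \<and> ?Q t" unfolding t_def
    by (rule GreatestI_nat[where P = "\<lambda>t. t \<le> ?m \<and> ?Q t" and k = 0 and b = ?m]) (use 0 in auto)
  have after: "\<not> ?Q u" if "t < u" "u \<le> ?m" for u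
    using that Greatest_le_nat[of "\<lambda>t. t \<le> ?m \<and> ?Q t" u ?m] unfolding t_def by force
  obtain k where k: "k \<le> i" "hdist (g t) (c k) \<le> B" using t by blast
  have "\<exists>l. i \<le> l \<and> l \<le> n \<and> hdist (g t) (c l) \<le> B + 1"
  proof (cases "t = ?m")
    case True
    then show ?thesis using i geodD(4)[OF g] by auto
  next
    case False
    then have u: "Suc t \<le> ?m" using t by simp
    obtain l where l: "l \<le> n" "hdist (g (Suc t)) (c l) \<le> B" using near[OF u] by blast
    have "i \<le> l" using after[OF _ u] l by (meson le_cases lessI)
    moreover have "hdist (g t) (c l) \<le> hdist (g t) (g (Suc t)) + hdist (g (Suc t)) (c l)"
      using u l cV gV by (intro hdist_triangle) auto
    moreover have "hdist (g t) (g (Suc t)) = 1" using geodD(6)[OF g, of t "Suc t"] u by simp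
    ultimately show ?thesis using l by auto
  qed
  then obtain l where l: "i \<le> l" "l \<le> n" "hdist (g t) (c l) \<le> B + 1" by blast
  have "hdist (c k) (c l) \<le> hdist (c k) (g t) + hdist (g t) (c l)"
    using k l t i cV gV by (intro hdist_triangle) auto
  then have "hdist (c k) (c l) \<le> 2 * B + 1" using k l hdist_commute[of "c k"] by simp
  then have "K * hdist (c k) (c l) \<le> K * (2 * B + 1)" by (rule mult_le_mono2)
  then have lk: "l - k \<le> K * (2 * B + 1) + K"
    using quasi_geodD(3)[OF c, of k l] k l by linarith
  have "hdist (c i) (g t) \<le> hdist (c i) (c k) + hdist (c k) (g t)"
    using k l t i cV gV by (intro hdist_triangle) auto
  also have "hdist (c i) (c k) \<le> i - k"
    using quasi_geod_lipschitz[OF c, of k i] k i hdist_commute[of "c i"] by simp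
  finally have "hdist (c i) (g t) \<le> K * (2 * B + 1) + K + B"
    using lk l k hdist_commute[of "c k"] by simp
  then show ?thesis using t by blast
qed

end

text \<open>
  The images of the sides of a geodesic triangle are quasi-geodesics, which stay close to the
  sides of a slim triangle with the same vertices. A point on one side is therefore close to
  another side after projection, and then also before projection, by the upper bound.
\<close>

lemma slim_pullback:
  fixes \<pi> :: "'w \<Rightarrow> 'v"
  assumes "connected_graph V' R'" "connected_graph V R"
    and \<pi>: "\<And>x. x \<in> V' \<Longrightarrow> \<pi> x \<in> V"
    and lower: "\<And>x y. x \<in> V' \<Longrightarrow> y \<in> V' \<Longrightarrow>
      connected_graph.hdist R (\<pi> x) (\<pi> y) \<le> connected_graph.hdist R' x y"
    and upper: "\<And>x y. x \<in> V' \<Longrightarrow> y \<in> V' \<Longrightarrow>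
      connected_graph.hdist R' x y \<le> K * connected_graph.hdist R (\<pi> x) (\<pi> y) + K"
    and "connected_graph.slim V R \<delta>"
  shows "\<exists>\<delta>'. connected_graph.slim V' R' \<delta>'"
proof -
  interpret Y: connected_graph V' R' by fact
  interpret X: connected_graph V R by fact
  obtain B where B: "\<And>c n g t. X.quasi_geod K c n \<Longrightarrow> X.geod g (c 0) (c n) \<Longrightarrow>
      t \<le> X.hdist (c 0) (c n) \<Longrightarrow> \<exists>k\<le>n. X.hdist (g t) (c k) \<le> B"
    using X.geodesic_near_quasi_geodesic[OF assms(6), of K] by metis
  define M where "M = K * (2 * B + 1) + K + B + \<delta> + B"
  have quasi: "X.quasi_geod K (\<lambda>i. \<pi> (g i)) (Y.hdist x y)" if g: "Y.geod g x y" for g x y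
    unfolding X.quasi_geod_def
  proof (intro conjI allI impI)
    fix i j assume ij: "i \<le> j" "j \<le> Y.hdist x y"
    show "j - i \<le> K * X.hdist (\<pi> (g i)) (\<pi> (g j)) + K"
      using upper[of "g i" "g j"] Y.geodD(5,6)[OF g] ij by simp
  next
    fix i assume i: "i < Y.hdist x y"
    show "X.hdist (\<pi> (g i)) (\<pi> (g (Suc i))) \<le> 1"
      using lower[of "g i" "g (Suc i)"] Y.geodD(5)[OF g] Y.geodD(6)[OF g, of i "Suc i"] i by simp
  qed (use Y.geodD(5)[OF g] \<pi> in auto)
  have "Y.slim (K * M + K)"
    unfolding Y.slim_def
  proof (intro allI impI)
    fix x y z g h k i
    assume g: "Y.geod g x y" and h: "Y.geod h x z" and k: "Y.geod k z y"
      and i: "i \<le> Y.hdist x y"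
    note V = Y.geodD(1,2)[OF g] Y.geodD(2)[OF h]
    obtain g0 where g0: "X.geod g0 (\<pi> x) (\<pi> y)" using X.geod_exists[OF \<pi> \<pi>] V by metis
    obtain h0 where h0: "X.geod h0 (\<pi> x) (\<pi> z)" using X.geod_exists[OF \<pi> \<pi>] V by metis
    obtain k0 where k0: "X.geod k0 (\<pi> z) (\<pi> y)" using X.geod_exists[OF \<pi> \<pi>] V by metis
    have near: "\<exists>j\<le>Y.hdist a b. X.hdist (f0 t) (\<pi> (f j)) \<le> B"
      if "Y.geod f a b" "X.geod f0 (\<pi> a) (\<pi> b)" "t \<le> X.hdist (\<pi> a) (\<pi> b)" for f f0 a b t
      using B[OF quasi[OF that(1)], of f0 t] that Y.geodD(3,4)[OF that(1)] by simp
    obtain t where t: "t \<le> X.hdist (\<pi> x) (\<pi> y)"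
      "X.hdist (\<pi> (g i)) (g0 t) \<le> K * (2 * B + 1) + K + B"
      using X.quasi_geodesic_near_geodesic[OF quasi[OF g], of g0 i B] g0 i near[OF g g0]
        Y.geodD(3,4)[OF g] by auto
    have close: "Y.hdist (g i) (f j) \<le> K * M + K"
      if f: "Y.geod f a b" "X.geod f0 (\<pi> a) (\<pi> b)" and u: "u \<le> X.hdist (\<pi> a) (\<pi> b)"
        and j: "j \<le> Y.hdist a b" and tu: "X.hdist (g0 t) (f0 u) \<le> \<delta>"
        and uj: "X.hdist (f0 u) (\<pi> (f j)) \<le> B" for f f0 a b j u
    proof -
      have V: "g i \<in> V'" "f j \<in> V'" "g0 t \<in> V" "f0 u \<in> V"
        using Y.geodD(5)[OF g i] Y.geodD(5)[OF f(1) j] X.geodD(5)[OF g0 t(1)]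
          X.geodD(5)[OF f(2) u] by auto
      have "X.hdist (\<pi> (g i)) (\<pi> (f j)) \<le> X.hdist (\<pi> (g i)) (g0 t) + X.hdist (g0 t) (\<pi> (f j))"
        using V \<pi> by (intro X.hdist_triangle) auto
      also have "X.hdist (g0 t) (\<pi> (f j)) \<le> X.hdist (g0 t) (f0 u) + X.hdist (f0 u) (\<pi> (f j))"
        using V \<pi> by (intro X.hdist_triangle) auto
      finally have "X.hdist (\<pi> (g i)) (\<pi> (f j)) \<le> M" using t(2) tu uj by (simp add: M_def)
      then have "K * X.hdist (\<pi> (g i)) (\<pi> (f j)) \<le> K * M" by (rule mult_le_mono2)
      then show ?thesis using upper[OF V(1,2)] by linarith
    qed
    have "(\<exists>u\<le>X.hdist (\<pi> x) (\<pi> z). X.hdist (g0 t) (h0 u) \<le> \<delta>)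
        \<or> (\<exists>u\<le>X.hdist (\<pi> z) (\<pi> y). X.hdist (g0 t) (k0 u) \<le> \<delta>)"
      using assms(6) g0 h0 k0 t(1) unfolding X.slim_def by blast
    then show "(\<exists>j\<le>Y.hdist x z. Y.hdist (g i) (h j) \<le> K * M + K)
        \<or> (\<exists>j\<le>Y.hdist z y. Y.hdist (g i) (k j) \<le> K * M + K)"
      using near[OF h h0] near[OF k k0] close[OF h h0] close[OF k k0] by meson
  qed
  then show ?thesis by blast
qed

section \<open>Walks and hyperbolicity in terms of the edge relation\<close>

context wf_digraph begin

lemma awalk_along_edges:
  assumes "f 0 \<in> verts G" "\<forall>i<n. (f i, f (Suc i)) \<in> arcs_ends G"
  shows "\<exists>p. awalk (f 0) p (f n) \<and> length p = n \<and> awalk_verts (f 0) p = map f [0..<Suc n]"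
  using assms
proof (induction n arbitrary: f)
  case (Suc n)
  obtain e where e: "e \<in> arcs G" "tail G e = f 0" "head G e = f 1"
    using Suc.prems(2) by (auto simp: arcs_ends_conv)
  obtain p where p: "awalk (f 1) p (f (Suc n))" "length p = n"
    "awalk_verts (f 1) p = map (\<lambda>i. f (Suc i)) [0..<Suc n]"
    using Suc.IH[of "\<lambda>i. f (Suc i)"] Suc.prems(2) head_in_verts[OF e(1)] e(3)
    by (auto simp del: upt_Suc)
  have "map f [0..<Suc (Suc n)] = f 0 # map (\<lambda>i. f (Suc i)) [0..<Suc n]"
    by (simp only: upt_rec[of 0 "Suc (Suc n)"] map_Suc_upt[symmetric]) simp
  then show ?case
    using e p by (intro exI[of _ "e # p"]) (auto simp: awalk_Cons_iff simp del: upt_Suc)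
qed (auto simp: awalk_Nil_iff)

lemma edges_of_awalk:
  assumes "awalk u p v"
  shows "awalk_verts u p ! 0 = u" "awalk_verts u p ! length p = v"
    "\<forall>i<length p. (awalk_verts u p ! i, awalk_verts u p ! Suc i) \<in> arcs_ends G"
proof -
  have "awalk_verts u p ! 0 = u \<and> awalk_verts u p ! length p = v \<and>
    (\<forall>i<length p. (awalk_verts u p ! i, awalk_verts u p ! Suc i) \<in> arcs_ends G)"
    using assms
  proof (induction p arbitrary: u)
    case (Cons e p)
    then have e: "e \<in> arcs G" "u = tail G e" "awalk (head G e) p v"
      by (auto simp: awalk_Cons_iff)
    then show ?case
      using Cons.IH[OF e(3)]
      by (auto simp: nth_Cons arcs_ends_conv split: nat.split)
  qed (auto simp: awalk_Nil_iff)
  then show "awalk_verts u p ! 0 = u" "awalk_verts u p ! length p = v"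
    "\<forall>i<length p. (awalk_verts u p ! i, awalk_verts u p ! Suc i) \<in> arcs_ends G" by auto
qed

lemma ex_awalk_iff_relpow:
  "(\<exists>p. awalk u p v \<and> length p = n) \<longleftrightarrow> u \<in> verts G \<and> (u, v) \<in> arcs_ends G ^^ n"
proof
  assume "\<exists>p. awalk u p v \<and> length p = n"
  then obtain p where "awalk u p v" "length p = n" by blast
  then show "u \<in> verts G \<and> (u, v) \<in> arcs_ends G ^^ n"
    using edges_of_awalk[of u p v]
    by (auto simp: relpow_fun_conv intro!: exI[of _ "(!) (awalk_verts u p)"])
next
  assume *: "u \<in> verts G \<and> (u, v) \<in> arcs_ends G ^^ n"
  then obtain f where "f 0 = u" "f n = v" "\<forall>i<n. (f i, f (Suc i)) \<in> arcs_ends G"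
    by (auto simp: relpow_fun_conv)
  then show "\<exists>p. awalk u p v \<and> length p = n"
    using awalk_along_edges[of f n] * by blast
qed

lemma awalk_cost_unit: "awalk_cost (\<lambda>_. 1) p = real (length p)"
  by (induction p) auto

text \<open>
  Lengths of walks are natural numbers, so the infimum in the definition of the distance is
  attained. In this form the lemma also applies to the graphs with a vertex removed in which
  angles are measured; these may be disconnected.
\<close>

lemma graph_dist_le_iff:
  "graph_dist G u v \<le> ereal r \<longleftrightarrow>
    u \<in> verts G \<and> (\<exists>n. real n \<le> r \<and> (u, v) \<in> arcs_ends G ^^ n)"
proof
  assume le: "graph_dist G u v \<le> ereal r"
  have ex: "\<exists>n p. awalk u p v \<and> length p = n"
  proof (rule ccontr)
    assume "\<not> ?thesis"
    then have "graph_dist G u v = \<infinity>"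
      unfolding graph_dist_def by (intro shortest_path_inf) (auto simp: reachable_awalk)
    then show False using le by simp
  qed
  define n where "n = (LEAST n. \<exists>p. awalk u p v \<and> length p = n)"
  have n: "\<exists>p. awalk u p v \<and> length p = n" unfolding n_def by (rule LeastI_ex[OF ex])
  have "ereal (real n) \<le> graph_dist G u v"
    unfolding graph_dist_def \<mu>_def awalk_cost_unit
    by (rule INF_greatest) (auto simp: n_def intro!: Least_le)
  then have "real n \<le> r" using order_trans[OF _ le] by fastforce
  then show "u \<in> verts G \<and> (\<exists>n. real n \<le> r \<and> (u, v) \<in> arcs_ends G ^^ n)"
    using n unfolding ex_awalk_iff_relpow by blast
next
  assume "u \<in> verts G \<and> (\<exists>n. real n \<le> r \<and> (u, v) \<in> arcs_ends G ^^ n)"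
  then obtain n p where "real n \<le> r" "awalk u p v" "length p = n"
    using ex_awalk_iff_relpow by metis
  then have "graph_dist G u v \<le> ereal (real n)"
    using min_cost_le_walk_cost[of u p v "\<lambda>_. 1"] by (simp add: graph_dist_def awalk_cost_unit)
  then show "graph_dist G u v \<le> ereal r" using \<open>real n \<le> r\<close> by (simp add: order_trans)
qed

end

lemma (in sym_digraph) connected_iff_rtrancl:
  "Digraph_Component.connected G \<longleftrightarrow>
    verts G \<noteq> {} \<and> (\<forall>u\<in>verts G. \<forall>v\<in>verts G. (u, v) \<in> (arcs_ends G)\<^sup>*)"
proof -
  have "u \<rightarrow>\<^sup>* v \<longleftrightarrow> u \<in> verts G \<and> (u, v) \<in> (arcs_ends G)\<^sup>*" for u v
    unfolding reachable_awalk rtrancl_power using ex_awalk_iff_relpow[of u v] by blast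
  then show ?thesis
    unfolding Digraph_Component.connected_def strongly_connected_def
    using reachable_mk_symmetric_eq[OF sym_arcs] by auto
qed

locale connected_sym_digraph =
  sym_digraph G + connected_graph "verts G" "arcs_ends G" for G :: "('v, 'e) pre_digraph" (structure)

lemma connected_sym_digraphI:
  assumes "sym_digraph G"
    and "\<And>u v. u \<in> verts G \<Longrightarrow> v \<in> verts G \<Longrightarrow> (u, v) \<in> (arcs_ends G)\<^sup>*"
  shows "connected_sym_digraph G"
proof -
  interpret sym_digraph G by fact
  show ?thesis using assms(2) sym_arcs by unfold_locales (auto simp: symmetric_def)
qed

context connected_sym_digraph
begin

lemma graph_dist_eq:
  assumes "u \<in> verts G" "v \<in> verts G"
  shows "graph_dist G u v = ereal (real (hdist u v))"
proof (rule antisym)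
  show "graph_dist G u v \<le> ereal (real (hdist u v))"
    unfolding graph_dist_le_iff using hdist_relpow[OF assms] assms by blast
  show "ereal (real (hdist u v)) \<le> graph_dist G u v"
    unfolding graph_dist_def \<mu>_def awalk_cost_unit
  proof (rule INF_greatest)
    fix p assume "p \<in> {p. awalk u p v}"
    then have "(u, v) \<in> arcs_ends G ^^ length p"
      using ex_awalk_iff_relpow[of u v "length p"] by blast
    then show "ereal (real (hdist u v)) \<le> ereal (real (length p))" using hdist_le by simp
  qed
qed

lemma geod_of_geodesic:
  assumes "geodesic G x p y"
  shows "geod ((!) (awalk_verts x p)) x y"
    "set (awalk_verts x p) = (!) (awalk_verts x p) ` {..hdist x y}"
proof -
  have w: "awalk x p y" and V: "x \<in> verts G" "y \<in> verts G" 
    using assms by (auto simp: geodesic_def)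
  have l: "length p = hdist x y"
    using assms graph_dist_eq[OF V] by (simp add: geodesic_def)
  show "geod ((!) (awalk_verts x p)) x y"
    using edges_of_awalk[OF w] V l by (intro geod_if_edges) auto
  show "set (awalk_verts x p) = (!) (awalk_verts x p) ` {..hdist x y}"
    using l by (auto simp: set_conv_nth length_awalk_verts image_iff less_Suc_eq_le)
qed

lemma geodesic_of_geod:
  assumes "geod g x y"
  obtains p where "geodesic G x p y" "set (awalk_verts x p) = g ` {..hdist x y}"
proof -
  have "\<forall>i<hdist x y. (g i, g (Suc i)) \<in> arcs_ends G" using geod_edges[OF assms] by blast
  then obtain p where p: "awalk x p y" "length p = hdist x y"
    "awalk_verts x p = map g [0..<Suc (hdist x y)]"
    using awalk_along_edges[of g "hdist x y"] geodD(1,3,4)[OF assms] by auto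
  have "set (awalk_verts x p) = g ` {..hdist x y}"
    unfolding p(3) by (auto simp: less_Suc_eq_le simp del: upt_Suc)
  moreover have "geodesic G x p y"
    using p(1,2) graph_dist_eq[of x y] geodD(1,2)[OF assms] by (simp add: geodesic_def)
  ultimately show ?thesis using that by blast
qed

lemma hyperbolic_iff_slim: "hyperbolic_graph G \<longleftrightarrow> (\<exists>\<delta>. slim \<delta>)"
proof
  assume "hyperbolic_graph G"
  then obtain \<delta> where \<delta>: "\<And>x y z p q r u. geodesic G x p y \<Longrightarrow> geodesic G y q z \<Longrightarrow>
      geodesic G z r x \<Longrightarrow> u \<in> set (awalk_verts x p) \<Longrightarrow>
      \<exists>w \<in> set (awalk_verts y q) \<union> set (awalk_verts z r). graph_dist G u w \<le> ereal \<delta>"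
    unfolding hyperbolic_graph_def by blast
  have "slim (nat \<lceil>\<delta>\<rceil>)"
    unfolding slim_def
  proof (intro allI impI)
    fix x y z g h k i
    assume g: "geod g x y" and h: "geod h x z" and k: "geod k z y" and i: "i \<le> hdist x y"
    obtain p where p: "geodesic G x p y" "set (awalk_verts x p) = g ` {..hdist x y}"
      using geodesic_of_geod[OF g] .
    obtain q where q: "geodesic G y q z"
      "set (awalk_verts y q) = (\<lambda>j. k (hdist z y - j)) ` {..hdist y z}"
      using geodesic_of_geod[OF geod_reverse[OF k]] .
    obtain r where r: "geodesic G z r x"
      "set (awalk_verts z r) = (\<lambda>j. h (hdist x z - j)) ` {..hdist z x}"
      using geodesic_of_geod[OF geod_reverse[OF h]] .
    obtain w where w: "w \<in> set (awalk_verts y q) \<union> set (awalk_verts z r)"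
      "graph_dist G (g i) w \<le> ereal \<delta>"
      using \<delta>[OF p(1) q(1) r(1), of "g i"] p(2) i by blast
    then have sides: "(\<exists>j\<le>hdist x z. w = h j) \<or> (\<exists>j\<le>hdist z y. w = k j)"
      using q(2) r(2) by (auto intro: diff_le_self)
    then have "w \<in> verts G" using geodD(5)[OF h] geodD(5)[OF k] by auto
    then have "hdist (g i) w \<le> nat \<lceil>\<delta>\<rceil>"
      using w(2) graph_dist_eq[of "g i" w] geodD(5)[OF g i] by (simp add: le_nat_iff le_ceiling_iff)
    then show "(\<exists>j\<le>hdist x z. hdist (g i) (h j) \<le> nat \<lceil>\<delta>\<rceil>)
        \<or> (\<exists>j\<le>hdist z y. hdist (g i) (k j) \<le> nat \<lceil>\<delta>\<rceil>)"
      using sides by blast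
  qed
  then show "\<exists>\<delta>. slim \<delta>" ..
next
  assume "\<exists>\<delta>. slim \<delta>"
  then obtain \<delta> where \<delta>: "slim \<delta>" ..
  show "hyperbolic_graph G"
    unfolding hyperbolic_graph_def
  proof (intro exI[of _ "real \<delta>"] allI impI ballI, elim conjE)
    fix x y z p q r u
    assume p: "geodesic G x p y" and q: "geodesic G y q z" and r: "geodesic G z r x"
      and u: "u \<in> set (awalk_verts x p)"
    note g = geod_of_geodesic[OF p] and h = geod_of_geodesic[OF q] and k = geod_of_geodesic[OF r]
    obtain i where i: "i \<le> hdist x y" "u = awalk_verts x p ! i" using u g(2) by auto
    have "(\<exists>j\<le>hdist x z. hdist u (awalk_verts z r ! (hdist z x - j)) \<le> \<delta>)
        \<or> (\<exists>j\<le>hdist z y. hdist u (awalk_verts y q ! (hdist y z - j)) \<le> \<delta>)"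
      using \<delta> g(1) geod_reverse[OF k(1)] geod_reverse[OF h(1)] i unfolding slim_def by blast
    moreover have "awalk_verts z r ! (hdist z x - j) \<in> set (awalk_verts z r)"
      "awalk_verts y q ! (hdist y z - j) \<in> set (awalk_verts y q)" for j
      using h(2) k(2) by auto
    ultimately obtain w where
      w: "w \<in> set (awalk_verts y q) \<union> set (awalk_verts z r)" "hdist u w \<le> \<delta>"
      by blast
    have "u \<in> verts G" "w \<in> verts G"
      using u w(1) p q r unfolding geodesic_def by (auto elim!: awalkE')
    then have "graph_dist G u w \<le> ereal (real \<delta>)" using w(2) graph_dist_eq by simp
    then show "\<exists>w\<in>set (awalk_verts y q) \<union> set (awalk_verts z r). graph_dist G u w \<le> ereal (real \<delta>)"
      using w(1) by blast
  qed
qed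

end

section \<open>Projections of graphs\<close>

lemma relpow_project:
  assumes "\<And>u v. (u, v) \<in> R' \<Longrightarrow> \<pi> u = \<pi> v \<or> (\<pi> u, \<pi> v) \<in> R"
  shows "(u, v) \<in> R' ^^ n \<Longrightarrow> \<exists>m\<le>n. (\<pi> u, \<pi> v) \<in> R ^^ m"
proof (induction n arbitrary: v)
  case (Suc n)
  then obtain w where "(u, w) \<in> R' ^^ n" and w: "(w, v) \<in> R'" by auto
  then obtain m where m: "m \<le> n" "(\<pi> u, \<pi> w) \<in> R ^^ m" using Suc.IH by blast
  show ?case
  proof (cases "\<pi> w = \<pi> v")
    case True
    then show ?thesis using m by (metis le_Suc_eq)
  next
    case False
    then have "(\<pi> u, \<pi> v) \<in> R ^^ Suc m" using assms[OF w] m by auto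
    then show ?thesis using m(1) Suc_le_mono by blast
  qed
qed auto

text \<open>
  The edges are lifted one by one from \<open>x\<close>; the walk obtained ends in the fibre of \<open>y\<close>, and a
  move within this fibre is added at the end.
\<close>

lemma relpow_lift:
  fixes \<pi> :: "'w \<Rightarrow> 'v"
  assumes lift: "\<And>x w. x \<in> V' \<Longrightarrow> (\<pi> x, w) \<in> R \<Longrightarrow> \<exists>y\<in>V'. \<pi> y = w \<and> (\<exists>m\<le>K. (x, y) \<in> R' ^^ m)"
    and fibre: "\<And>x y. x \<in> V' \<Longrightarrow> y \<in> V' \<Longrightarrow> \<pi> x = \<pi> y \<Longrightarrow> \<exists>m\<le>K. (x, y) \<in> R' ^^ m"
    and x: "x \<in> V'" and y: "y \<in> V'" and xy: "(\<pi> x, \<pi> y) \<in> R ^^ n"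
  shows "\<exists>m\<le>K * n + K. (x, y) \<in> R' ^^ m"
proof -
  have *: "(\<pi> x, w) \<in> R ^^ n \<Longrightarrow> \<exists>z\<in>V'. \<pi> z = w \<and> (\<exists>m\<le>K * n. (x, z) \<in> R' ^^ m)" for n w
  proof (induction n arbitrary: w)
    case 0
    then show ?case using x by (intro bexI[of _ x]) auto
  next
    case (Suc n)
    then obtain v where "(\<pi> x, v) \<in> R ^^ n" and v: "(v, w) \<in> R" by auto
    then obtain z m where z: "z \<in> V'" "\<pi> z = v" "m \<le> K * n" "(x, z) \<in> R' ^^ m"
      using Suc.IH by blast
    obtain z' l where z': "z' \<in> V'" "\<pi> z' = w" "l \<le> K" "(z, z') \<in> R' ^^ l"
      using lift[OF z(1)] v z(2) by blast
    have "(x, z') \<in> R' ^^ (m + l)" using z(4) z'(4) by (auto simp: relpow_add)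
    moreover have "m + l \<le> K * Suc n" using z(3) z'(3) by simp
    ultimately show ?case using z' by blast
  qed
  obtain z m where z: "z \<in> V'" "\<pi> z = \<pi> y" "m \<le> K * n" "(x, z) \<in> R' ^^ m" using *[OF xy] by blast
  obtain l where l: "l \<le> K" "(z, y) \<in> R' ^^ l" using fibre[OF z(1) y z(2)] by blast
  have "(x, y) \<in> R' ^^ (m + l)" using z(4) l(2) by (auto simp: relpow_add)
  then show ?thesis using z(3) l(1) by (intro exI[of _ "m + l"]) auto
qed

text \<open>
  Lifting a shortest walk edge by edge connects any two vertices of \<open>\<Gamma>'\<close> and gives the upper
  bound in \<open>slim_pullback\<close>; projecting a shortest walk gives the lower one.
\<close>

lemma hyperbolic_by_projection:
  fixes \<Gamma>' :: "('w, 'e) pre_digraph" and \<Gamma> :: "('v, 'f) pre_digraph" and \<pi> :: "'w \<Rightarrow> 'v"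
  assumes graphs: "sym_digraph \<Gamma>'" "sym_digraph \<Gamma>" and ne: "verts \<Gamma>' \<noteq> {}"
    and \<pi>: "\<And>x. x \<in> verts \<Gamma>' \<Longrightarrow> \<pi> x \<in> verts \<Gamma>"
    and project: "\<And>u v. (u, v) \<in> arcs_ends \<Gamma>' \<Longrightarrow> \<pi> u = \<pi> v \<or> (\<pi> u, \<pi> v) \<in> arcs_ends \<Gamma>"
    and lift: "\<And>x w. x \<in> verts \<Gamma>' \<Longrightarrow> (\<pi> x, w) \<in> arcs_ends \<Gamma> \<Longrightarrow>
      \<exists>y\<in>verts \<Gamma>'. \<pi> y = w \<and> (\<exists>m\<le>K. (x, y) \<in> arcs_ends \<Gamma>' ^^ m)"
    and fibre: "\<And>x y. x \<in> verts \<Gamma>' \<Longrightarrow> y \<in> verts \<Gamma>' \<Longrightarrow> \<pi> x = \<pi> y \<Longrightarrow>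
      \<exists>m\<le>K. (x, y) \<in> arcs_ends \<Gamma>' ^^ m"
    and conn: "Digraph_Component.connected \<Gamma>" and hyp: "hyperbolic_graph \<Gamma>"
  shows "Digraph_Component.connected \<Gamma>' \<and> hyperbolic_graph \<Gamma>'"
proof -
  interpret Y0: sym_digraph \<Gamma>' by fact
  interpret X0: sym_digraph \<Gamma> by fact
  interpret X: connected_sym_digraph \<Gamma>
    using conn X0.connected_iff_rtrancl by (intro connected_sym_digraphI graphs) blast
  have lifted: "\<exists>m\<le>K * X.hdist (\<pi> x) (\<pi> y) + K. (x, y) \<in> arcs_ends \<Gamma>' ^^ m"
    if "x \<in> verts \<Gamma>'" "y \<in> verts \<Gamma>'" for x y
    using relpow_lift[of "verts \<Gamma>'" \<pi> "arcs_ends \<Gamma>" K "arcs_ends \<Gamma>'", OF lift fibre that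
        X.hdist_relpow[OF \<pi> \<pi>, OF that]] by blast
  have joined: "(x, y) \<in> (arcs_ends \<Gamma>')\<^sup>*" if "x \<in> verts \<Gamma>'" "y \<in> verts \<Gamma>'" for x y
    using lifted[OF that] by (auto intro: relpow_imp_rtrancl)
  interpret Y: connected_sym_digraph \<Gamma>' by (intro connected_sym_digraphI graphs joined)
  have lower: "X.hdist (\<pi> x) (\<pi> y) \<le> Y.hdist x y" if V: "x \<in> verts \<Gamma>'" "y \<in> verts \<Gamma>'" for x y
  proof -
    obtain m where "m \<le> Y.hdist x y" "(\<pi> x, \<pi> y) \<in> arcs_ends \<Gamma> ^^ m"
      using relpow_project[of "arcs_ends \<Gamma>'" \<pi> "arcs_ends \<Gamma>", OF project Y.hdist_relpow[OF V]] by blast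
    then show ?thesis using X.hdist_le by (meson order_trans)
  qed
  have upper: "Y.hdist x y \<le> K * X.hdist (\<pi> x) (\<pi> y) + K"
    if "x \<in> verts \<Gamma>'" "y \<in> verts \<Gamma>'" for x y
    using lifted[OF that] Y.hdist_le by (meson order_trans)
  obtain \<delta> where "X.slim \<delta>" using hyp X.hyperbolic_iff_slim by blast
  then have "\<exists>\<delta>. Y.slim \<delta>"
    using slim_pullback[of "verts \<Gamma>'" "arcs_ends \<Gamma>'" "verts \<Gamma>" "arcs_ends \<Gamma>" \<pi> K \<delta>]
      Y.connected_graph_axioms X.connected_graph_axioms \<pi> lower upper by blast
  then show ?thesis using Y.hyperbolic_iff_slim Y0.connected_iff_rtrancl joined ne by blast
qed

text \<open>
  A walk avoiding \<open>c\<close> is projected to a walk avoiding \<open>\<pi> c\<close>, since \<open>c\<close> is alone in its fibre.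
  So angles at \<open>c\<close> are at least the angles at \<open>\<pi> c\<close>, and balls in the neighbourhood of \<open>c\<close>
  embed into finite balls.
\<close>

lemma fine_at_by_projection:
  fixes \<Gamma>' :: "('w, 'e) pre_digraph" and \<Gamma> :: "('v, 'f) pre_digraph" and \<pi> :: "'w \<Rightarrow> 'v"
  assumes "wf_digraph \<Gamma>'" "wf_digraph \<Gamma>"
    and project: "\<And>u v. (u, v) \<in> arcs_ends \<Gamma>' \<Longrightarrow> \<pi> u = \<pi> v \<or> (\<pi> u, \<pi> v) \<in> arcs_ends \<Gamma>"
    and \<pi>: "\<And>u. u \<in> verts \<Gamma>' \<Longrightarrow> \<pi> u \<in> verts \<Gamma>"
    and cone: "\<And>u. u \<in> verts \<Gamma>' \<Longrightarrow> \<pi> u = \<pi> c \<Longrightarrow> u = c"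
    and no_loop: "(c, c) \<notin> arcs_ends \<Gamma>'"
    and inj: "inj_on \<pi> (adjacent_verts \<Gamma>' c)"
    and fine: "fine_at \<Gamma> (\<pi> c)"
  shows "fine_at \<Gamma>' c"
proof -
  interpret Y: wf_digraph \<Gamma>' by fact
  interpret X: wf_digraph \<Gamma> by fact
  interpret Yc: wf_digraph "Y.del_vert c" by (rule Y.wf_digraph_del_vert)
  interpret Xc: wf_digraph "X.del_vert (\<pi> c)" by (rule X.wf_digraph_del_vert)
  have del: "arcs_ends (Y.del_vert c) = {(u, v) \<in> arcs_ends \<Gamma>'. u \<noteq> c \<and> v \<noteq> c}"
    "arcs_ends (X.del_vert (\<pi> c)) = {(u, v) \<in> arcs_ends \<Gamma>. u \<noteq> \<pi> c \<and> v \<noteq> \<pi> c}"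
    by (auto simp: arcs_ends_conv Y.del_vert_simps X.del_vert_simps)
  have off: "\<pi> u \<noteq> \<pi> c" if "u \<in> verts \<Gamma>'" "u \<noteq> c" for u
    using cone that by blast
  have project_del: "\<pi> u = \<pi> v \<or> (\<pi> u, \<pi> v) \<in> arcs_ends (X.del_vert (\<pi> c))"
    if "(u, v) \<in> arcs_ends (Y.del_vert c)" for u v
    using that project[of u v] off[of u] off[of v] Y.adj_in_verts[of u v] unfolding del by blast
  have adj: "x \<noteq> c" "x \<in> verts \<Gamma>'" "\<pi> x \<in> adjacent_verts \<Gamma> (\<pi> c)" if "x \<in> adjacent_verts \<Gamma>' c" for x
  proof -
    have e: "(c, x) \<in> arcs_ends \<Gamma>'" using that by (simp add: adjacent_verts_def)
    then show x: "x \<noteq> c" "x \<in> verts \<Gamma>'" using no_loop Y.adj_in_verts[OF e] by auto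
    show "\<pi> x \<in> adjacent_verts \<Gamma> (\<pi> c)"
      using project[OF e] off[OF x(2,1)] by (auto simp: adjacent_verts_def)
  qed
  show ?thesis
    unfolding fine_at_def
  proof (intro ballI allI)
    fix x and n :: real assume x: "x \<in> adjacent_verts \<Gamma>' c"
    let ?A = "{y \<in> adjacent_verts \<Gamma>' c. angle_dist \<Gamma>' c x y \<le> ereal n}"
    let ?B = "{y \<in> adjacent_verts \<Gamma> (\<pi> c). angle_dist \<Gamma> (\<pi> c) (\<pi> x) y \<le> ereal n}"
    have "\<pi> ` ?A \<subseteq> ?B"
    proof (rule image_subsetI)
      fix y assume y: "y \<in> ?A"
      obtain k where k: "real k \<le> n" "(x, y) \<in> arcs_ends (Y.del_vert c) ^^ k"
        using y unfolding angle_dist_def Yc.graph_dist_le_iff by blast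
      obtain m where m: "m \<le> k" "(\<pi> x, \<pi> y) \<in> arcs_ends (X.del_vert (\<pi> c)) ^^ m"
        using relpow_project[of "arcs_ends (Y.del_vert c)" \<pi> "arcs_ends (X.del_vert (\<pi> c))",
            OF project_del k(2)] by blast
      have "real m \<le> n" using m(1) k(1) by linarith
      moreover have "\<pi> x \<in> verts (X.del_vert (\<pi> c))"
        using adj[OF x] \<pi> off by (simp add: X.verts_del_vert)
      ultimately have "angle_dist \<Gamma> (\<pi> c) (\<pi> x) (\<pi> y) \<le> ereal n"
        unfolding angle_dist_def Xc.graph_dist_le_iff using m(2) by blast
      then show "\<pi> y \<in> ?B" using adj y by blast
    qed
    moreover have "finite ?B" using fine adj[OF x] unfolding fine_at_def by blast
    moreover have "inj_on \<pi> ?A" using inj by (rule inj_on_subset) blast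
    ultimately show "finite ?A" by (meson inj_on_finite)
  qed
qed

section \<open>Coned-off Cayley graphs and cosets\<close>

lemma symcl_iff: "(u, v) \<in> symcl R \<longleftrightarrow> (u, v) \<in> R \<or> (v, u) \<in> R"
  by (auto simp: symcl_def)

lemma coned_off_verts [simp]:
  "Inl x \<in> verts (coned_off_cayley G \<P> S) \<longleftrightarrow> x \<in> carrier G"
  "Inr C \<in> verts (coned_off_cayley G \<P> S) \<longleftrightarrow> C \<in> left_cosets G \<P>"
  by (auto simp: coned_off_cayley_def)

lemma coned_off_edges [simp]:
  "(Inl x, Inl y) \<in> arcs_ends (coned_off_cayley G \<P> S) \<longleftrightarrow>
    (x \<in> carrier G \<and> (\<exists>s\<in>S. y = x \<otimes>\<^bsub>G\<^esub> s)) \<or> (y \<in> carrier G \<and> (\<exists>s\<in>S. x = y \<otimes>\<^bsub>G\<^esub> s))"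
  "(Inl x, Inr C) \<in> arcs_ends (coned_off_cayley G \<P> S) \<longleftrightarrow> C \<in> left_cosets G \<P> \<and> x \<in> C"
  "(Inr C, Inl x) \<in> arcs_ends (coned_off_cayley G \<P> S) \<longleftrightarrow> C \<in> left_cosets G \<P> \<and> x \<in> C"
  "(Inr C, Inr D) \<notin> arcs_ends (coned_off_cayley G \<P> S)"
  unfolding coned_off_cayley_def with_proj_simps pair_pre_digraph.simps symcl_iff by auto

text \<open>
  The quotients of elements of a coset recover the subgroup, so cosets of different subgroups
  are different sets.
\<close>

lemma (in group) subgroup_of_coset:
  assumes "subgroup L G" "a \<in> carrier G"
  shows "L = {inv x \<otimes> y | x y. x \<in> a <# L \<and> y \<in> a <# L}"
proof -
  have *: "inv (a \<otimes> k) \<otimes> (a \<otimes> l) = inv k \<otimes> l" if "k \<in> L" "l \<in> L" for k l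
    using that assms subgroup.mem_carrier[OF assms(1)]
    by (simp add: inv_mult_group m_assoc) (simp flip: m_assoc)
  show ?thesis
  proof (intro equalityI subsetI)
    fix l assume "l \<in> L"
    then have "l = inv (a \<otimes> \<one>) \<otimes> (a \<otimes> l)"
      using *[of \<one> l] subgroup.one_closed[OF assms(1)] subgroup.mem_carrier[OF assms(1)] by simp
    then show "l \<in> {inv x \<otimes> y | x y. x \<in> a <# L \<and> y \<in> a <# L}"
      using \<open>l \<in> L\<close> subgroup.one_closed[OF assms(1)] unfolding l_coset_def by blast
  next
    fix l assume "l \<in> {inv x \<otimes> y | x y. x \<in> a <# L \<and> y \<in> a <# L}"
    then obtain j k where "j \<in> L" "k \<in> L" "l = inv (a \<otimes> j) \<otimes> (a \<otimes> k)"
      unfolding l_coset_def by blast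
    then show "l \<in> L"
      using * subgroup.m_closed[OF assms(1)] subgroup.m_inv_closed[OF assms(1)] by simp
  qed
qed

locale free_peripheral_action = group A for A :: "('a, 'm) monoid_scheme" (structure) +
  fixes T :: "'a set" and \<H> \<H>F :: "'a set set" and F :: "('a \<Rightarrow> 'a) set"
  assumes T_carrier: "T \<subseteq> carrier A"
    and \<H>_subgroup: "K \<in> \<H> \<Longrightarrow> subgroup K A"
    and F_subgroup: "subgroup F (AutoGroup A)"
    and T_invariant: "f \<in> F \<Longrightarrow> f ` T = T"
    and \<H>_invariant: "f \<in> F \<Longrightarrow> K \<in> \<H> \<Longrightarrow> f ` K \<in> \<H>"
    and free: "f \<in> F \<Longrightarrow> K \<in> \<H> \<Longrightarrow> f ` K = K \<Longrightarrow> f = \<one>\<^bsub>AutoGroup A\<^esub>"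
    and representatives: "orbit_representatives ((AutoGroup A)\<lparr>carrier := F\<rparr>) \<H> (`) \<H>F"
begin

abbreviation "Aut \<equiv> AutoGroup A"
abbreviation "G \<equiv> natural_semidirect A F"
abbreviation "\<P> \<equiv> (`) (base_emb A) ` \<H>F"
abbreviation "S \<equiv> base_emb A ` T \<union> aut_emb A ` F"
abbreviation "\<Gamma> \<equiv> coned_off_cayley A \<H> T"
abbreviation "\<Gamma>' \<equiv> coned_off_cayley G \<P> S"

sublocale Aut: group "AutoGroup A" by (rule AutoGroup)

lemmas F_mult_closed = subgroup.m_closed[OF F_subgroup]
  and F_one_closed = subgroup.one_closed[OF F_subgroup]
  and F_inv_closed = subgroup.m_inv_closed[OF F_subgroup]
  and F_carrier = subgroup.mem_carrier[OF F_subgroup]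

lemma F_auto: "f \<in> F \<Longrightarrow> f \<in> auto A"
  using F_carrier by (simp add: AutoGroup_def)

lemma F_hom: "f \<in> F \<Longrightarrow> f \<in> hom A A"
  using F_auto by (auto simp: auto_def)

lemma F_one: "f \<in> F \<Longrightarrow> f \<one> = \<one>"
  using hom_one[OF F_hom] is_group by blast

lemma Aut_mult_apply: "f \<in> F \<Longrightarrow> h \<in> F \<Longrightarrow> a \<in> carrier A \<Longrightarrow> (f \<otimes>\<^bsub>Aut\<^esub> h) a = f (h a)"
  using F_auto[of f] F_auto[of h] by (simp add: AutoGroup_def BijGroup_def auto_def compose_eq)

lemma Aut_one_apply: "a \<in> carrier A \<Longrightarrow> \<one>\<^bsub>Aut\<^esub> a = a"
  by (simp add: AutoGroup_def BijGroup_def)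

lemma Aut_mult_image:
  "f \<in> F \<Longrightarrow> h \<in> F \<Longrightarrow> K \<subseteq> carrier A \<Longrightarrow> (f \<otimes>\<^bsub>Aut\<^esub> h) ` K = f ` h ` K"
  using Aut_mult_apply by (auto simp: image_iff subset_iff)

lemma Aut_one_image: "K \<subseteq> carrier A \<Longrightarrow> \<one>\<^bsub>Aut\<^esub> ` K = K"
  using Aut_one_apply by (force simp: image_iff subset_iff)

lemma F_inv_image: "f \<in> F \<Longrightarrow> K \<subseteq> carrier A \<Longrightarrow> (inv\<^bsub>Aut\<^esub> f) ` f ` K = K"
  using Aut_mult_image[of "inv\<^bsub>Aut\<^esub> f" f K] F_inv_closed[of f] F_carrier[of f] Aut_one_image[of K]
  by simp

lemma \<H>_carrier: "K \<in> \<H> \<Longrightarrow> K \<subseteq> carrier A"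
  using \<H>_subgroup subgroup.subset by blast

section \<open>Orbit representatives\<close>

lemma \<H>F_subset: "\<H>F \<subseteq> \<H>"
  using representatives by (simp add: orbit_representatives_def)

lemma representative_unique:
  assumes "K \<in> \<H>F" "L \<in> \<H>F" "f \<in> F" "f ` K = L"
  shows "K = L"
proof -
  have "orbit (Aut\<lparr>carrier := F\<rparr>) (`) K \<in> orbits (Aut\<lparr>carrier := F\<rparr>) \<H> (`)"
    using assms(1) \<H>F_subset unfolding orbits_def by blast
  then have "\<exists>!x. x \<in> \<H>F \<inter> orbit (Aut\<lparr>carrier := F\<rparr>) (`) K"
    using representatives unfolding orbit_representatives_def by blast
  moreover have "K \<in> orbit (Aut\<lparr>carrier := F\<rparr>) (`) K"
    using Aut_one_image[of K] F_one_closed \<H>_carrier \<H>F_subset assms(1)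
    unfolding orbit_def by fastforce
  moreover have "L \<in> orbit (Aut\<lparr>carrier := F\<rparr>) (`) K"
    using assms unfolding orbit_def by auto
  ultimately show ?thesis using assms by blast
qed

lemma representative_exists:
  assumes "L \<in> \<H>"
  obtains f K where "f \<in> F" "K \<in> \<H>F" "L = f ` K"
proof -
  have "orbit (Aut\<lparr>carrier := F\<rparr>) (`) L \<in> orbits (Aut\<lparr>carrier := F\<rparr>) \<H> (`)"
    using assms unfolding orbits_def by blast
  then obtain K where "K \<in> \<H>F" "K \<in> orbit (Aut\<lparr>carrier := F\<rparr>) (`) L"
    using representatives unfolding orbit_representatives_def by blast
  then obtain g where "g \<in> F" "K = g ` L" "K \<in> \<H>F" unfolding orbit_def by auto
  moreover have "L = (inv\<^bsub>Aut\<^esub> g) ` K"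
    using F_inv_image[of g L] \<H>_carrier[OF assms] \<open>g \<in> F\<close> \<open>K = g ` L\<close> by simp
  ultimately show ?thesis using that F_inv_closed by blast
qed

text \<open>
  If \<open>f(K) = h(L)\<close>, then \<open>K\<close> and \<open>L\<close> are in one orbit, so they coincide, and \<open>h\<^sup>-\<^sup>1 f\<close> fixes
  \<open>K\<close>; freeness makes it trivial.
\<close>

lemma translate_unique:
  assumes "K \<in> \<H>F" "L \<in> \<H>F" "f \<in> F" "h \<in> F" "f ` K = h ` L"
  shows "f = h" "K = L"
proof -
  have car: "K \<subseteq> carrier A" "L \<subseteq> carrier A" using assms \<H>F_subset \<H>_carrier by auto
  let ?g = "inv\<^bsub>Aut\<^esub> h \<otimes>\<^bsub>Aut\<^esub> f"
  have g: "?g \<in> F" using assms F_inv_closed F_mult_closed by blast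
  have "?g ` K = L"
    using Aut_mult_image[of "inv\<^bsub>Aut\<^esub> h" f K] F_inv_image[of h L] F_inv_closed assms car by simp
  then show KL: "K = L" using representative_unique assms g by blast
  then have "?g = \<one>\<^bsub>Aut\<^esub>" using free[OF g] \<open>?g ` K = L\<close> assms \<H>F_subset by blast
  then have "h \<otimes>\<^bsub>Aut\<^esub> ?g = h \<otimes>\<^bsub>Aut\<^esub> \<one>\<^bsub>Aut\<^esub>" by simp
  then show "f = h" using F_carrier assms by (simp flip: Aut.m_assoc)
qed

section \<open>Cosets in the semidirect product\<close>

lemma carrier_G: "carrier G = carrier A \<times> F"
  by (simp add: natural_semidirect_def semidirect_def)

lemma mult_G: "(a, f) \<otimes>\<^bsub>G\<^esub> (b, h) = (a \<otimes> f b, f \<otimes>\<^bsub>Aut\<^esub> h)"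
  by (simp add: natural_semidirect_def semidirect_def)

lemma mult_base: "f \<in> F \<Longrightarrow> (a, f) \<otimes>\<^bsub>G\<^esub> base_emb A b = (a \<otimes> f b, f)"
  by (simp add: base_emb_def mult_G F_carrier)

lemma mult_aut: "a \<in> carrier A \<Longrightarrow> f \<in> F \<Longrightarrow> (a, f) \<otimes>\<^bsub>G\<^esub> aut_emb A h = (a, f \<otimes>\<^bsub>Aut\<^esub> h)"
  by (simp add: aut_emb_def mult_G F_one)

lemma group_G: "group G"
  using group_natural_semidirect[OF is_group F_subgroup] .

lemma base_emb_hom: "base_emb A \<in> hom A G"
  by (auto simp: hom_def carrier_G mult_G base_emb_def F_one_closed Aut_one_apply)

lemma inj_base_emb: "inj (base_emb A)"
  by (auto simp: inj_def base_emb_def)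

lemma left_cosets_G:
  "left_cosets G \<P> = {(a <# f ` K) \<times> {f} | a f K. a \<in> carrier A \<and> f \<in> F \<and> K \<in> \<H>F}"
proof -
  have "(a, f) <#\<^bsub>G\<^esub> base_emb A ` K = (a <# f ` K) \<times> {f}" if "f \<in> F" for a f K
    using that by (auto simp: l_coset_def mult_base)
  then show ?thesis
    unfolding left_cosets_def LCOSETS_def carrier_G by (fastforce simp: Sigma_def)
qed

lemma coset_layer:
  assumes "D \<in> left_cosets G \<P>"
  obtains f where "f \<in> F" "D = (fst ` D) \<times> {f}"
  using assms unfolding left_cosets_G by (auto simp: image_iff)

lemma coset_project:
  assumes "D \<in> left_cosets G \<P>"
  shows "fst ` D \<in> left_cosets A \<H>"
proof -
  obtain a f K where D: "D = (a <# f ` K) \<times> {f}" "a \<in> carrier A" "f \<in> F" "K \<in> \<H>F"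
    using assms unfolding left_cosets_G by blast
  have "fst ` D = a <# f ` K" unfolding D(1) by auto
  moreover have "f ` K \<in> \<H>" using \<H>_invariant D \<H>F_subset by blast
  ultimately show ?thesis using D(2) unfolding left_cosets_def LCOSETS_def by auto
qed

lemma coset_lift:
  assumes "C \<in> left_cosets A \<H>"
  obtains f where "f \<in> F" "C \<times> {f} \<in> left_cosets G \<P>"
proof -
  obtain a L where C: "a \<in> carrier A" "L \<in> \<H>" "C = a <# L"
    using assms unfolding left_cosets_def LCOSETS_def by auto
  obtain f K where "f \<in> F" "K \<in> \<H>F" "L = f ` K" using representative_exists[OF C(2)] .
  then show ?thesis using C that[of f] unfolding left_cosets_G by blast
qed

text \<open>
  The common projection is a coset of only one subgroup \<open>f(K)\<close> of \<open>A\<close>, and by freeness this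
  subgroup determines the layer \<open>f\<close>.
\<close>

lemma coset_unique:
  assumes "D \<in> left_cosets G \<P>" "E \<in> left_cosets G \<P>" "fst ` D = fst ` E"
  shows "D = E"
proof -
  obtain a f K where D: "D = (a <# f ` K) \<times> {f}" "a \<in> carrier A" "f \<in> F" "K \<in> \<H>F"
    using assms unfolding left_cosets_G by blast
  obtain b h L where E: "E = (b <# h ` L) \<times> {h}" "b \<in> carrier A" "h \<in> F" "L \<in> \<H>F"
    using assms unfolding left_cosets_G by blast
  have eq: "a <# f ` K = b <# h ` L" using assms(3) unfolding D(1) E(1) by (simp add: fst_image_times)
  have "subgroup (f ` K) A" "subgroup (h ` L) A"
    using D E \<H>F_subset \<H>_invariant \<H>_subgroup by blast+
  then have "f ` K = h ` L"
    using subgroup_of_coset[of "f ` K" a] subgroup_of_coset[of "h ` L" b] D(2) E(2) eq by simp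
  then have "f = h" using translate_unique D E by blast
  then show ?thesis using eq D(1) E(1) by simp
qed

section \<open>The projection of coned-off Cayley graphs\<close>

text \<open>
  A generator \<open>t \<in> T\<close> leads from \<open>(a, f)\<close> to \<open>(a f(t), f)\<close>, and \<open>f(t)\<close> runs through all of
  \<open>T\<close>; a generator \<open>h \<in> F\<close> leads to \<open>(a, f h)\<close>, and \<open>f h\<close> runs through all of \<open>F\<close>.
\<close>

lemma layer_edges:
  "(Inl (a, f), Inl (b, g)) \<in> arcs_ends \<Gamma>' \<longleftrightarrow>
    a \<in> carrier A \<and> b \<in> carrier A \<and> f \<in> F \<and> g \<in> F \<and>
    (a = b \<or> f = g \<and> (Inl a, Inl b) \<in> arcs_ends \<Gamma>)"
proof -
  have step: "(\<exists>s\<in>S. (b, g) = (a, f) \<otimes>\<^bsub>G\<^esub> s) \<longleftrightarrow>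
      g \<in> F \<and> (a = b \<or> f = g \<and> (\<exists>t\<in>T. b = a \<otimes> t))"
    if a: "a \<in> carrier A" and f: "f \<in> F" for a b f g
  proof -
    have "(\<exists>s\<in>base_emb A ` T. (b, g) = (a, f) \<otimes>\<^bsub>G\<^esub> s) \<longleftrightarrow> f = g \<and> (\<exists>t\<in>f ` T. b = a \<otimes> t)"
      using f by (auto simp: mult_base)
    moreover have "(\<exists>s\<in>aut_emb A ` F. (b, g) = (a, f) \<otimes>\<^bsub>G\<^esub> s) \<longleftrightarrow> a = b \<and> g \<in> F"
    proof
      assume "a = b \<and> g \<in> F"
      then have "(b, g) = (a, f) \<otimes>\<^bsub>G\<^esub> aut_emb A (inv\<^bsub>Aut\<^esub> f \<otimes>\<^bsub>Aut\<^esub> g)"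
        using a f F_carrier by (simp add: mult_aut flip: Aut.m_assoc)
      moreover have "inv\<^bsub>Aut\<^esub> f \<otimes>\<^bsub>Aut\<^esub> g \<in> F"
        using f \<open>a = b \<and> g \<in> F\<close> F_inv_closed F_mult_closed by blast
      ultimately show "\<exists>s\<in>aut_emb A ` F. (b, g) = (a, f) \<otimes>\<^bsub>G\<^esub> s" by blast
    qed (use a f F_mult_closed in \<open>auto simp: mult_aut\<close>)
    ultimately show ?thesis using f T_invariant[OF f] by (auto simp: bex_Un)
  qed
  have "(Inl (a, f), Inl (b, g)) \<in> arcs_ends \<Gamma>' \<longleftrightarrow>
      (a \<in> carrier A \<and> f \<in> F) \<and> (\<exists>s\<in>S. (b, g) = (a, f) \<otimes>\<^bsub>G\<^esub> s) \<or>
      (b \<in> carrier A \<and> g \<in> F) \<and> (\<exists>s\<in>S. (a, f) = (b, g) \<otimes>\<^bsub>G\<^esub> s)"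
    by (simp only: coned_off_edges carrier_G mem_Sigma_iff)
  also have "\<dots> \<longleftrightarrow>
      (a \<in> carrier A \<and> f \<in> F) \<and> g \<in> F \<and> (a = b \<or> f = g \<and> (\<exists>t\<in>T. b = a \<otimes> t)) \<or>
      (b \<in> carrier A \<and> g \<in> F) \<and> f \<in> F \<and> (b = a \<or> g = f \<and> (\<exists>t\<in>T. a = b \<otimes> t))"
    using step[of a f b g] step[of b g a f] by argo
  also have "\<dots> \<longleftrightarrow> a \<in> carrier A \<and> b \<in> carrier A \<and> f \<in> F \<and> g \<in> F \<and>
      (a = b \<or> f = g \<and> (Inl a, Inl b) \<in> arcs_ends \<Gamma>)"
    using T_carrier by auto
  finally show ?thesis .
qed

definition proj :: "('a \<times> ('a \<Rightarrow> 'a)) + ('a \<times> ('a \<Rightarrow> 'a)) set \<Rightarrow> 'a + 'a set" where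
  "proj = map_sum fst ((`) fst)"

lemma proj_simps [simp]: "proj (Inl (a, f)) = Inl a" "proj (Inr D) = Inr (fst ` D)"
  by (simp_all add: proj_def)

lemma proj_verts: "x \<in> verts \<Gamma>' \<Longrightarrow> proj x \<in> verts \<Gamma>"
  by (cases x) (auto simp: carrier_G coset_project)

lemma proj_edge:
  assumes "(u, v) \<in> arcs_ends \<Gamma>'"
  shows "proj u = proj v \<or> (proj u, proj v) \<in> arcs_ends \<Gamma>"
proof -
  have coset: "fst x \<in> fst ` D \<and> fst ` D \<in> left_cosets A \<H>" if "D \<in> left_cosets G \<P>" "x \<in> D" for x D
    using that coset_project by blast
  consider (ll) a f b g where "u = Inl (a, f)" "v = Inl (b, g)" | (lr) a f D where "u = Inl (a, f)" "v = Inr D"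
    | (rl) a f D where "v = Inl (a, f)" "u = Inr D" | (rr) D E where "u = Inr D" "v = Inr E"
    by (metis old.sum.exhaust prod.exhaust)
  then show ?thesis
  proof cases
    case ll
    then show ?thesis using assms by (auto simp only: layer_edges proj_simps)
  qed (use assms coset in force)+
qed

text \<open>
  Two steps may be needed from an element to a cone vertex over its coset: this cone vertex is
  attached to one layer only, and the first step moves there.
\<close>

lemma proj_edge_lift:
  assumes x: "x \<in> verts \<Gamma>'" and e: "(proj x, w) \<in> arcs_ends \<Gamma>"
  shows "\<exists>y\<in>verts \<Gamma>'. proj y = w \<and> (\<exists>m\<le>2. (x, y) \<in> arcs_ends \<Gamma>' ^^ m)"
proof -
  consider (ll) a f b where "x = Inl (a, f)" "w = Inl b" | (lr) a f C where "x = Inl (a, f)" "w = Inr C"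
    | (rl) a D where "w = Inl a" "x = Inr D" | (rr) D C where "x = Inr D" "w = Inr C"
    by (metis old.sum.exhaust prod.exhaust)
  then show ?thesis
  proof cases
    case ll
    have "a \<in> carrier A" "f \<in> F" using x ll(1) by (auto simp: carrier_G)
    moreover have e': "(Inl a, Inl b) \<in> arcs_ends \<Gamma>" using e ll by simp
    moreover have "b \<in> carrier A" using e' T_carrier \<open>a \<in> carrier A\<close> by auto
    ultimately have "(x, Inl (b, f)) \<in> arcs_ends \<Gamma>' ^^ 1" "Inl (b, f) \<in> verts \<Gamma>'"
      unfolding ll relpow_1 layer_edges by (simp_all add: carrier_G)
    then show ?thesis using ll by (intro bexI[of _ "Inl (b, f)"] conjI exI[of _ 1]) auto
  next
    case lr
    have af: "a \<in> carrier A" "f \<in> F" using x lr(1) by (auto simp: carrier_G)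
    have C: "C \<in> left_cosets A \<H>" "a \<in> C" using e lr by auto
    obtain h where h: "h \<in> F" "C \<times> {h} \<in> left_cosets G \<P>" using coset_lift[OF C(1)] .
    have "(x, Inl (a, h)) \<in> arcs_ends \<Gamma>'" unfolding lr layer_edges using af h by blast
    moreover have "(Inl (a, h), Inr (C \<times> {h})) \<in> arcs_ends \<Gamma>'" using C h by simp
    ultimately have "(x, Inr (C \<times> {h})) \<in> arcs_ends \<Gamma>' ^^ 2" by (auto simp: numeral_2_eq_2)
    moreover have "proj (Inr (C \<times> {h})) = w" using lr by (simp add: fst_image_times)
    ultimately show ?thesis using h(2) by (intro bexI[of _ "Inr (C \<times> {h})"] conjI exI[of _ 2]) auto
  next
    case rl
    have D: "D \<in> left_cosets G \<P>" "a \<in> fst ` D" using e rl x by auto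
    obtain f where f: "f \<in> F" "D = (fst ` D) \<times> {f}" using coset_layer[OF D(1)] .
    have aD: "(a, f) \<in> D" using D(2) f(2) by blast
    then have "(x, Inl (a, f)) \<in> arcs_ends \<Gamma>' ^^ 1" using rl D(1) by simp
    moreover have "a \<in> carrier A"
      using coset_project[OF D(1)] D(2) subgroup.lcosets_carrier[OF \<H>_subgroup is_group]
      unfolding left_cosets_def by blast
    ultimately show ?thesis
      using rl f by (intro bexI[of _ "Inl (a, f)"] conjI exI[of _ 1]) (auto simp: carrier_G)
  qed (use e in simp)
qed

lemma proj_fibre:
  assumes "x \<in> verts \<Gamma>'" "y \<in> verts \<Gamma>'" "proj x = proj y"
  shows "\<exists>m\<le>2. (x, y) \<in> arcs_ends \<Gamma>' ^^ m"
proof (cases x)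
  case (Inl p)
  then obtain a f h where "x = Inl (a, f)" "y = Inl (a, h)"
    using assms(3) by (cases y; cases p) auto
  then have "(x, y) \<in> arcs_ends \<Gamma>' ^^ 1"
    unfolding relpow_1 using assms(1,2) by (simp only: layer_edges coned_off_verts carrier_G) simp
  then show ?thesis by (intro exI[of _ 1]) simp
next
  case (Inr D)
  then obtain E where "y = Inr E" using assms(3) by (cases y) auto
  then have "x = y" using coset_unique[of D E] assms Inr by simp
  then show ?thesis by (intro exI[of _ 0]) simp
qed

lemma S_carrier: "S \<subseteq> carrier G"
  using T_carrier F_one_closed by (auto simp: carrier_G base_emb_def aut_emb_def)

lemma \<P>_subgroup:
  assumes "P \<in> \<P>"
  shows "subgroup P G"
proof -
  interpret group_hom A G "base_emb A"
    using group_G base_emb_hom is_group by (intro group_hom.intro group_hom_axioms.intro)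
  show ?thesis using assms subgroup_img_is_subgroup \<H>_subgroup \<H>F_subset by auto
qed

lemma hyperbolically_embedded_semidirect:
  assumes "hyperbolically_embedded A \<H> T"
  shows "hyperbolically_embedded G \<P> S"
proof -
  have inf: "\<And>K. K \<in> \<H> \<Longrightarrow> infinite K" and conn: "Digraph_Component.connected \<Gamma>"
    and hyp: "hyperbolic_graph \<Gamma>" and fine: "\<And>C. C \<in> left_cosets A \<H> \<Longrightarrow> fine_at \<Gamma> (Inr C)"
    using assms by (auto simp: hyperbolically_embedded_def)
  have sym: "sym_digraph \<Gamma>" "sym_digraph \<Gamma>'"
    using sym_digraph_coned_off_cayley is_group group_G \<H>_subgroup \<P>_subgroup T_carrier S_carrier by blast+
  have "Inl (\<one>, \<one>\<^bsub>Aut\<^esub>) \<in> verts \<Gamma>'" using F_one_closed by (simp add: carrier_G)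
  then have ne: "verts \<Gamma>' \<noteq> {}" by blast
  have "Digraph_Component.connected \<Gamma>' \<and> hyperbolic_graph \<Gamma>'"
    using hyperbolic_by_projection[of \<Gamma>' \<Gamma> proj 2, OF sym(2,1) ne proj_verts proj_edge
        proj_edge_lift proj_fibre conn hyp] by blast
  moreover have "fine_at \<Gamma>' (Inr D)" if D: "D \<in> left_cosets G \<P>" for D
  proof (rule fine_at_by_projection[of \<Gamma>' \<Gamma> proj, OF _ _ proj_edge proj_verts])
    show "wf_digraph \<Gamma>'" "wf_digraph \<Gamma>" using sym by (auto simp: sym_digraph_def)
    show "u = Inr D" if "u \<in> verts \<Gamma>'" "proj u = proj (Inr D)" for u
      using that coset_unique[of _ D] D by (cases u) (auto simp: proj_def)
    show "(Inr D, Inr D) \<notin> arcs_ends \<Gamma>'" by simp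
    show "fine_at \<Gamma> (proj (Inr D))" using fine coset_project[OF D] by simp
    obtain f where f: "D = (fst ` D) \<times> {f}" using coset_layer[OF D] .
    have "\<exists>a. x = Inl (a, f)" if "x \<in> adjacent_verts \<Gamma>' (Inr D)" for x
    proof (cases x)
      case (Inl p)
      then have "p \<in> (fst ` D) \<times> {f}" using that f by (simp add: adjacent_verts_def)
      then show ?thesis using Inl by blast
    qed (use that in \<open>simp add: adjacent_verts_def\<close>)
    then show "inj_on proj (adjacent_verts \<Gamma>' (Inr D))"
      by (intro inj_onI) (metis Inl_inject proj_simps(1))
  qed
  moreover have "infinite P" if P: "P \<in> \<P>" for P
  proof -
    obtain K where K: "K \<in> \<H>F" "P = base_emb A ` K" using P by blast
    then have "infinite K" using inf \<H>F_subset by blast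
    then show ?thesis unfolding K(2) by (meson finite_imageD inj_base_emb inj_on_subset top_greatest)
  qed
  ultimately show ?thesis
    using \<P>_subgroup S_carrier by (simp only: hyperbolically_embedded_def) blast
qed

end

theorem theoremF:
  fixes A :: "('a, 'm) monoid_scheme"
    and T :: "'a set"
    and \<H> \<H>F :: "'a set set"
    and F :: "('a \<Rightarrow> 'a) set"
  assumes "group A"
    and "finitely_generated A"
    and "T \<subseteq> carrier A" and "generate A T = carrier A"
    and "finite \<H>"
    and "\<And>K. K \<in> \<H> \<Longrightarrow> subgroup K A \<and> infinite K"
    and "hyperbolically_embedded A \<H> T"
    and "subgroup F (AutoGroup A)" and "finite F"
    and T_invariant: "\<And>f. f \<in> F \<Longrightarrow> f ` T = T"
    and \<H>_invariant: "\<And>f K. f \<in> F \<Longrightarrow> K \<in> \<H> \<Longrightarrow> f ` K \<in> \<H>"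
    and free: "\<And>f K. f \<in> F \<Longrightarrow> K \<in> \<H> \<Longrightarrow> f ` K = K \<Longrightarrow> f = \<one>\<^bsub>AutoGroup A\<^esub>"
    and "orbit_representatives ((AutoGroup A)\<lparr>carrier := F\<rparr>) \<H> (`) \<H>F"
  shows "hyperbolically_embedded (natural_semidirect A F)
           ((`) (base_emb A) ` \<H>F) (base_emb A ` T \<union> aut_emb A ` F)"
proof -
  interpret free_peripheral_action A T \<H> \<H>F F
    using assms by (intro free_peripheral_action.intro free_peripheral_action_axioms.intro) auto
  show ?thesis by (rule hyperbolically_embedded_semidirect) fact
qed

end
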